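(* There are absolute constants $c_0,c_1>0$ such that the following holds. Let $N,d\ge1$ and $K\in\{1,\dots,N\}$ be integers with $K$ dividing $N$. Let $\tilde X_1,\dots,\tilde X_N$ be independent random vectors in $\mathbb{R}^d$ with mean $\mu$ and invertible covariance matrix $\Sigma$. Let $X_1,\dots,X_N$ be an adversarially corrupted version of them in which at most $|\mathcal{O}|$ vectors have been modified. Assume that for some $0<\epsilon<1/8$ and constants $0<\varphi_l(\epsilon)<\varphi_u(\epsilon)$, for all $v\in\mathbb{R}^d$ with $\|v\|_2=1$, $$\max\left(W_v\left(\tfrac14-2\epsilon\right)-W_v\left(\tfrac12+2\epsilon\right),\,W_v\left(\tfrac12-2\epsilon\right)-W_v\left(\tfrac34+2\epsilon\right)\right)\le\varphi_u(\epsilon)$$ and $$\min\left(W_v\left(\tfrac14+2\epsilon\right)-W_v\left(\tfrac12-2\epsilon\right),\,W_v\left(\tfrac12+2\epsilon\right)-W_v\left(\tfrac34-2\epsilon\right)\right)\ge\varphi_l(\epsilon).$$ Assume that $|\mathcal{O}|\le\epsilon K$ and $K\ge c_0\epsilon^{-2}d$. Let $u>0$ and $r^*$ be such that $$C_0\left(\sqrt{\frac{d+1}{K}}+\sqrt{\frac uK}\right)+\sup_{\|v\|_2=1}H_{N,K,v}(r^* )+\frac{|\mathcal{O}|}{K}<\frac12.$$ Then, with probability at least $1-\exp(-u)-\exp(-c_1\epsilon^2K)$, for all $\nu\in\mathbb{R}^d$: if $\|\Sigma^{-1/2}(\nu-\mu)\|_2\ge2\sqrt{K/N}\,r^*$ then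 $$\frac{\|\Sigma^{-1/2}(\nu-\mu)\|_2}{2\varphi_u(\epsilon)\sqrt{K/N}}\le SDO_K(\nu)\le\frac{3\|\Sigma^{-1/2}(\nu-\mu)\|_2}{2\varphi_l(\epsilon)\sqrt{K/N}},$$ and if $\|\Sigma^{-1/2}(\nu-\mu)\|_2\le2\sqrt{K/N}\,r^*$ then $SDO_K(\nu)\le(3/\varphi_l(\epsilon))r^*$.
   Context: $C_0$ is the absolute constant of the following concentration inequality: for all independent random vectors $Y_1,\dots,Y_n$ in $\mathbb{R}^d$, every class $\mathcal F$ of functions from $\mathbb{R}^d$ to $\{0,1\}$ with finite Vapnik-Chervonenkis dimension $VC(\mathcal F)$ and every $u>0$, with probability at least $1-\exp(-u)$, $\sup_{f\in\mathcal F}\frac1n\sum_{i=1}^n (f(Y_i)-\mathbb{E}f(Y_i))\le C_0\left(\sqrt{VC(\mathcal F)/n}+\sqrt{u/n}\right)$. Blocks: $B_1\sqcup\dots\sqcup B_K=\{1,\dots,N\}$ is a fixed partition into $K$ blocks of equal size $N/K$, and $\bar X_k=\frac{1}{|B_k|}\sum_{i\in B_k}X_i$ are the block means of the corrupted data. $$SDO_K(\nu)=\sup_{v\in\mathbb{R}^d}\frac{|\langle\nu,v\rangle-\mathrm{Med}(\langle\bar X_k,v\rangle)|}{\mathrm{Med}(|\langle\bar X_k,v\rangle-\mathrm{Med}(\langle\bar X_k,v\rangle)|)},$$ where the supremum is over nonzero $v$ (with $a/0=+\infty$ for $a>0$ and $0/0=0$) and the medians are over $k\in\{1,\dots,K\}$;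 $\mathrm{Med}$ is the usual empirical median (the middle order statistic for an odd number of terms, the midpoint of the two middle order statistics for an even number). For $\|v\|_2=1$, $r\in\mathbb{R}$ and $p\in(0,1)$ (in terms of the uncorrupted vectors): $$H_v(r)=H_{N,K,v}(r)=\mathbb{P}\left[\frac{1}{\sqrt{N/K}}\sum_{i=1}^{N/K}\langle\Sigma^{-1/2}(\tilde X_i-\mu),v\rangle\ge r\right],\qquad W_v(p)=\max\{r\in\mathbb{R}:H_v(r)\ge p\}.$$ Adversarial corruption: the adversary sees all of $\tilde X_1,\dots,\tilde X_N$ and replaces at most $|\mathcal{O}|$ of them by arbitrary vectors; the set $\mathcal{O}$ of modified indices and the new vectors may depend arbitrarily on all the $\tilde X_i$'s, and $X_i=\tilde X_i$ for $i\notin\mathcal{O}$. Here $|\mathcal{O}|$ is a deterministic upper bound on the number of modified vectors. "With probability at least $p$" means there is an event of probability at least $p$ on which the conclusion holds. Absolute constants depend on no parameter.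
   Formalization: Added assumption: for every block and unit v, the standardized block sum has tail H_v (automatic for i.i.d. data); without it the claim fails, as H_v sees only the first N/K vectors. The sample space is the fixed set of sequences of real sequences, which realizes every joint law. *)

theory Defs
  imports "HOL-Probability.Probability" "HOL-Library.Extended_Nat"
begin

text \<open>
  Since absolute constants must not depend on the dimension \<open>d\<close>, the space
  \<open>\<real>\<^sup>d\<close> is represented by functions on \<open>{..<d}\<close> and not by a type; only the
  coordinates below \<open>d\<close> of a vector or a matrix are ever used. For the same
  reason all random variables live on probability spaces over one fixed type,
  large enough to carry any sequence of random vectors.
\<close>

type_synonym vect = "nat \<Rightarrow> real"
type_synonym matr = "nat \<Rightarrow> nat \<Rightarrow> real"
type_synonym outcome = "nat \<Rightarrow> nat \<Rightarrow> real"

abbreviation euclid :: "nat \<Rightarrow> vect measure" where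
  "euclid d \<equiv> Pi\<^sub>M {..<d} (\<lambda>_. borel)"

definition dot :: "nat \<Rightarrow> vect \<Rightarrow> vect \<Rightarrow> real" where
  "dot d x y = (\<Sum>j<d. x j * y j)"

abbreviation norm2 :: "nat \<Rightarrow> vect \<Rightarrow> real" where
  "norm2 d x \<equiv> L2_set x {..<d}"

definition mat_vec :: "nat \<Rightarrow> matr \<Rightarrow> vect \<Rightarrow> vect" where
  "mat_vec d A x = (\<lambda>i. \<Sum>j<d. A i j * x j)"

definition mat_mul :: "nat \<Rightarrow> matr \<Rightarrow> matr \<Rightarrow> matr" where
  "mat_mul d A B = (\<lambda>i l. \<Sum>j<d. A i j * B j l)"

definition inverse_mat :: "nat \<Rightarrow> matr \<Rightarrow> matr \<Rightarrow> bool" where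
  "inverse_mat d A B \<longleftrightarrow> (\<forall>i<d. \<forall>l<d.
     mat_mul d A B i l = of_bool (i = l) \<and> mat_mul d B A i l = of_bool (i = l))"

definition invertible_matr :: "nat \<Rightarrow> matr \<Rightarrow> bool" where
  "invertible_matr d A \<longleftrightarrow> (\<exists>B. inverse_mat d A B)"

text \<open>\<open>inv_sqrt_mat d A S\<close> says \<open>S = A\<^bsup>-1/2\<^esup>\<close>: for symmetric positive definite
  \<open>A\<close>, exactly one \<open>S\<close> (up to entries out of range) satisfies it.\<close>

definition inv_sqrt_mat :: "nat \<Rightarrow> matr \<Rightarrow> matr \<Rightarrow> bool" where
  "inv_sqrt_mat d A S \<longleftrightarrow>
     (\<forall>i<d. \<forall>j<d. S i j = S j i) \<and>
     (\<forall>x. 0 \<le> dot d (mat_vec d S x) x) \<and>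
     inverse_mat d A (mat_mul d S S)"

definition has_mean :: "'w measure \<Rightarrow> nat \<Rightarrow> ('w \<Rightarrow> vect) \<Rightarrow> vect \<Rightarrow> bool" where
  "has_mean M d Y mu \<longleftrightarrow>
     (\<forall>j<d. integrable M (\<lambda>\<omega>. Y \<omega> j) \<and> (LINT \<omega>|M. Y \<omega> j) = mu j)"

definition has_covariance ::
  "'w measure \<Rightarrow> nat \<Rightarrow> ('w \<Rightarrow> vect) \<Rightarrow> vect \<Rightarrow> matr \<Rightarrow> bool" where
  "has_covariance M d Y mu Sg \<longleftrightarrow>
     (\<forall>j<d. \<forall>l<d. integrable M (\<lambda>\<omega>. (Y \<omega> j - mu j) * (Y \<omega> l - mu l)) \<and>
        (LINT \<omega>|M. (Y \<omega> j - mu j) * (Y \<omega> l - mu l)) = Sg j l)"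

definition shatters :: "(vect \<Rightarrow> real) set \<Rightarrow> vect set \<Rightarrow> bool" where
  "shatters F A \<longleftrightarrow> (\<forall>T\<subseteq>A. \<exists>f\<in>F. \<forall>x\<in>A. f x = 1 \<longleftrightarrow> x \<in> T)"

definition vc_dim :: "nat \<Rightarrow> (vect \<Rightarrow> real) set \<Rightarrow> enat" where
  "vc_dim d F =
     (SUP A\<in>{A. finite A \<and> A \<subseteq> space (euclid d) \<and> shatters F A}. enat (card A))"

text \<open>
  \<open>vc_deviation_constant C\<close>: the deviation inequality for classes of finite
  VC dimension holds with constant \<open>C\<close>. Only countable classes of measurable
  functions are considered: for arbitrary uncountable classes the supremum need
  not be measurable, and under the continuum hypothesis no constant works for
  them (take the initial segments of a well-ordering of type \<open>\<omega>\<^sub>1\<close> of the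
  reals). This only enlarges the set of admissible \<open>C\<close>. Closed half-spaces are
  pointwise limits of those with rational coefficients.
\<close>

definition vc_deviation_constant :: "real \<Rightarrow> bool" where
  "vc_deviation_constant C \<longleftrightarrow> 0 < C \<and>
     (\<forall>(d::nat) (n::nat) (M :: outcome measure) (Y :: nat \<Rightarrow> outcome \<Rightarrow> vect)
        (F :: (vect \<Rightarrow> real) set) (V::nat) (u::real).
        1 \<le> d \<and> 1 \<le> n \<and> prob_space M \<and>
        prob_space.indep_vars M (\<lambda>_. euclid d) Y {1..n} \<and>
        countable F \<and>
        (\<forall>f\<in>F. f \<in> borel_measurable (euclid d) \<and> (\<forall>x\<in>space (euclid d). f x \<in> {0, 1})) \<and>
        vc_dim d F = enat V \<and> 0 < u \<longrightarrow>
        (\<exists>E\<in>sets M. 1 - exp (- u) \<le> measure M E \<and>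
           (\<forall>\<omega>\<in>E. \<forall>f\<in>F.
              (\<Sum>i=1..n. f (Y i \<omega>) - (LINT \<omega>'|M. f (Y i \<omega>'))) / real n
              \<le> C * (sqrt (real V / real n) + sqrt (u / real n)))))"

definition equal_block_partition :: "nat \<Rightarrow> nat \<Rightarrow> (nat \<Rightarrow> nat set) \<Rightarrow> bool" where
  "equal_block_partition N K B \<longleftrightarrow>
     (\<Union>k\<in>{1..K}. B k) = {1..N} \<and> disjoint_family_on B {1..K} \<and>
     (\<forall>k\<in>{1..K}. card (B k) = N div K)"

text \<open>The corrupted vectors may depend on the outcome in an arbitrary, possibly
  non-measurable way.\<close>

definition adversarial_corruption ::
  "'w measure \<Rightarrow> nat \<Rightarrow> nat \<Rightarrow> (nat \<Rightarrow> 'w \<Rightarrow> vect) \<Rightarrow> (nat \<Rightarrow> 'w \<Rightarrow> vect) \<Rightarrow> bool" where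
  "adversarial_corruption M N m Xt X \<longleftrightarrow>
     (\<forall>\<omega>\<in>space M. \<exists>Out. Out \<subseteq> {1..N} \<and> card Out \<le> m \<and>
        (\<forall>i\<in>{1..N} - Out. X i \<omega> = Xt i \<omega>))"

definition block_mean :: "nat set \<Rightarrow> (nat \<Rightarrow> vect) \<Rightarrow> vect" where
  "block_mean I x = (\<lambda>j. (\<Sum>i\<in>I. x i j) / real (card I))"

definition emp_median :: "real list \<Rightarrow> real" where
  "emp_median xs = (let ys = sort xs; n = length xs in
     if odd n then ys ! (n div 2) else (ys ! (n div 2 - 1) + ys ! (n div 2)) / 2)"

definition Med :: "nat \<Rightarrow> (nat \<Rightarrow> real) \<Rightarrow> real" where
  "Med K a = emp_median (map a [1..<Suc K])"

text \<open>In \<^typ>\<open>ereal\<close>, \<open>a / 0 = \<infinity>\<close> for \<open>a > 0\<close> and \<open>0 / 0 = 0\<close>.\<close>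

definition SDO :: "nat \<Rightarrow> nat \<Rightarrow> (nat \<Rightarrow> nat set) \<Rightarrow> (nat \<Rightarrow> vect) \<Rightarrow> vect \<Rightarrow> ereal" where
  "SDO d K B x nu = (SUP v\<in>{v. \<exists>j<d. v j \<noteq> 0}.
     (let a = (\<lambda>k. dot d (block_mean (B k) x) v) in
       ereal \<bar>dot d nu v - Med K a\<bar> / ereal (Med K (\<lambda>k. \<bar>a k - Med K a\<bar>))))"

text \<open>\<open>S\<close> plays the role of \<open>\<Sg>\<^bsup>-1/2\<^esup>\<close>.\<close>

definition std_tail :: "'w measure \<Rightarrow> nat \<Rightarrow> matr \<Rightarrow> vect \<Rightarrow> (nat \<Rightarrow> 'w \<Rightarrow> vect) \<Rightarrow>
    nat set \<Rightarrow> vect \<Rightarrow> real \<Rightarrow> real" where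
  "std_tail M d S mu Xt I v r = measure M {\<omega> \<in> space M.
     1 / sqrt (real (card I)) * (\<Sum>i\<in>I. dot d (mat_vec d S (\<lambda>j. Xt i \<omega> j - mu j)) v) \<ge> r}"

definition W_quantile :: "(real \<Rightarrow> real) \<Rightarrow> real \<Rightarrow> real" where
  "W_quantile H p = (GREATEST r. H r \<ge> p)"

end

theory Submission
  imports Defs
begin

text \<open>
  Every direction of \<open>\<real>\<^sup>d\<close> has the form \<open>c * \<Sigma>\<^bsup>-1/2\<^esup> v\<close> with \<open>c > 0\<close> and \<open>v\<close> a unit vector, and a
  ratio \<open>|x - Med| / MAD\<close> is invariant under positive affine maps (MAD is the median of the
  absolute deviations from the median). With \<open>n = N / K\<close>, \<open>\<eta> = \<Sigma>\<^bsup>-1/2\<^esup> (\<nu> - \<mu>)\<close> and \<open>z v k\<close> the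
  coordinate of the \<open>k\<close>-th standardized block mean along \<open>v\<close>, the outlyingness of \<open>\<nu>\<close> is therefore
  the supremum over unit vectors of \<open>|sqrt n * \<langle>\<eta>, v\<rangle> - Med (z v)| / MAD (z v)\<close>
  (lemma \<open>SDO_eq_SUP_unit\<close>). If \<open>|Med (z v)| < r\<close> and \<open>\<phi>l \<le> MAD (z v) \<le> \<phi>u\<close> for all \<open>v\<close>, the
  triangle inequality gives the upper bound \<open>(sqrt n * |\<eta>| + r) / \<phi>l\<close> and the choice
  \<open>v = \<eta> / |\<eta>|\<close> gives the lower bound \<open>(sqrt n * |\<eta>| - r) / \<phi>u\<close> (lemma \<open>SDO_bounds\<close>). Comparing
  \<open>r\<close> with \<open>sqrt n * |\<eta>| / 2\<close> yields all the inequalities of the theorem.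

  Both properties of \<open>z\<close> are statements about the fraction of blocks with \<open>z v k \<ge> t\<close>. For the
  original data this fraction is the empirical measure of a half-space under the \<open>K\<close> independent
  block means, and half-spaces have Vapnik-Chervonenkis dimension at most \<open>d + 1\<close>, so it differs
  from its expectation \<open>H v t\<close> by at most
  \<open>C0 * (sqrt ((d + 1) / K) + sqrt (u / K))\<close>, uniformly in \<open>v\<close> and \<open>t\<close>, with probability
  \<open>1 - exp (- u)\<close> (lemma \<open>standardized_block_deviation\<close>). A corrupted vector spoils only its own
  block, so corruption moves the fraction by at most \<open>m / K\<close>. At \<open>t = r\<close> the fraction is thus below
  \<open>1/2\<close> for both \<open>v\<close> and \<open>-v\<close>, whence \<open>|Med (z v)| < r\<close>. Applying the deviation bound a second time
  with \<open>u = c1 * \<epsilon>\<^sup>2 * K\<close>, the fraction is within \<open>2 * \<epsilon>\<close> of \<open>H v t\<close> for all \<open>t\<close>, which pins the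
  empirical median and quartiles between values of \<open>W v\<close> and so bounds the MAD (lemma
  \<open>MAD_bounds\<close>).
\<close>

section \<open>Half-spaces and their Vapnik-Chervonenkis dimension\<close>

definition halfspace_ind :: "nat \<Rightarrow> vect \<Rightarrow> real \<Rightarrow> vect \<Rightarrow> real" where
  "halfspace_ind d w b = (\<lambda>x. of_bool (b \<le> dot d x w))"

text \<open>Coefficient lists of arbitrary length over the rationals make the class countable by construction.\<close>

definition rational_halfspaces :: "nat \<Rightarrow> (vect \<Rightarrow> real) set" where
  "rational_halfspaces d =
     range (\<lambda>(qs :: rat list, q :: rat). halfspace_ind d (\<lambda>j. real_of_rat (qs ! j)) (real_of_rat q))"

text \<open>Complements are included so that a one-sided deviation inequality for the class is a two-sided one.\<close>

definition rational_halfspaces_compl :: "nat \<Rightarrow> (vect \<Rightarrow> real) set" where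
  "rational_halfspaces_compl d =
     rational_halfspaces d \<union> (\<lambda>f x. 1 - f x) ` rational_halfspaces d"

text \<open>More unknowns \<open>l x\<close> than homogeneous equations: Gaussian elimination of one equation and one
  unknown per step.\<close>

lemma exists_linear_dependence:
  fixes g :: "nat \<Rightarrow> 'a \<Rightarrow> real"
  assumes "finite A" "n < card A"
  shows "\<exists>l. (\<exists>x\<in>A. l x \<noteq> 0) \<and> (\<forall>j<n. (\<Sum>x\<in>A. l x * g j x) = 0)"
  using assms
proof (induction n arbitrary: A g)
  case 0
  then have "A \<noteq> {}" by auto
  then show ?case by (intro exI[of _ "\<lambda>_. 1"]) auto
next
  case (Suc n)
  show ?case
  proof (cases "\<forall>x\<in>A. g n x = 0")
    case True
    obtain l where "\<exists>x\<in>A. l x \<noteq> 0" "\<forall>j<n. (\<Sum>x\<in>A. l x * g j x) = 0"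
      using Suc.IH[of A g] Suc.prems by auto
    with True show ?thesis by (auto simp: less_Suc_eq intro!: exI[of _ l])
  next
    case False
    then obtain a where a: "a \<in> A" "g n a \<noteq> 0" by auto
    define A' where "A' = A - {a}"
    have A': "finite A'" "n < card A'" "a \<notin> A'" and A_eq: "A = insert a A'"
      using Suc.prems a by (auto simp: A'_def)
    obtain l where l: "\<exists>x\<in>A'. l x \<noteq> 0"
      "\<And>j. j < n \<Longrightarrow> (\<Sum>x\<in>A'. l x * (g j x - g n x / g n a * g j a)) = 0"
      using Suc.IH[of A' "\<lambda>j x. g j x - g n x / g n a * g j a"] A' by blast
    define l' where "l' = l(a := - (\<Sum>x\<in>A'. l x * g n x) / g n a)"
    have sum_l': "(\<Sum>x\<in>A. l' x * g j x) =
        (\<Sum>x\<in>A'. l x * g j x) - (\<Sum>x\<in>A'. l x * g n x) / g n a * g j a" for j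
    proof -
      have "(\<Sum>x\<in>A'. l' x * g j x) = (\<Sum>x\<in>A'. l x * g j x)"
        using A'(3) by (intro sum.cong) (auto simp: l'_def)
      then show ?thesis using A' by (simp add: A_eq l'_def)
    qed
    have "(\<Sum>x\<in>A. l' x * g j x) = 0" if "j < Suc n" for j
    proof (cases "j = n")
      case True
      then show ?thesis using a(2) by (simp add: sum_l')
    next
      case False
      then have "j < n" using that by simp
      have "(\<Sum>x\<in>A'. l x * (g j x - g n x / g n a * g j a)) =
          (\<Sum>x\<in>A'. l x * g j x) - (\<Sum>x\<in>A'. l x * g n x) / g n a * g j a"
        by (simp add: sum_subtractf right_diff_distrib sum_divide_distrib sum_distrib_right mult.assoc)
      then show ?thesis using l(2)[OF \<open>j < n\<close>] by (simp add: sum_l')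
    qed
    moreover have "\<exists>x\<in>A. l' x \<noteq> 0" using l(1) A'(3) by (auto simp: A_eq l'_def)
    ultimately show ?thesis by blast
  qed
qed

text \<open>The \<open>d\<close> coordinate functions together with the constant function give \<open>d + 1\<close> linear equations.\<close>

lemma exists_affine_dependence:
  assumes "finite A" "d + 1 < card A"
  obtains l :: "vect \<Rightarrow> real" where "\<exists>x\<in>A. l x \<noteq> 0" "(\<Sum>x\<in>A. l x) = 0"
    "\<And>w. (\<Sum>x\<in>A. l x * dot d x w) = 0"
proof -
  obtain l where l: "\<exists>x\<in>A. l x \<noteq> (0::real)"
    "\<And>j. j < Suc d \<Longrightarrow> (\<Sum>x\<in>A. l x * (if j < d then x j else 1)) = 0"
    using exists_linear_dependence[OF assms(1), of "Suc d" "\<lambda>j x. if j < d then x j else 1"] assms(2)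
    by auto
  have "(\<Sum>x\<in>A. l x) = 0" using l(2)[of d] by simp
  moreover have "(\<Sum>x\<in>A. l x * dot d x w) = 0" for w
  proof -
    have "(\<Sum>x\<in>A. l x * dot d x w) = (\<Sum>j<d. (\<Sum>x\<in>A. l x * x j) * w j)"
      unfolding dot_def sum_distrib_left sum_distrib_right by (subst sum.swap) (simp add: mult.assoc)
    also have "\<dots> = 0"
    proof (intro sum.neutral ballI)
      fix j assume "j \<in> {..<d}"
      then show "(\<Sum>x\<in>A. l x * x j) * w j = 0" using l(2)[of j] by simp
    qed
    finally show ?thesis .
  qed
  ultimately show ?thesis using that l(1) by blast
qed

text \<open>Radon's argument. For an affine dependence \<open>l\<close> on the points, \<open>\<Sum> l x * (\<langle>x, w\<rangle> - b) = 0\<close> for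
  every \<open>w\<close> and \<open>b\<close>; if a half-space cut out exactly the points with \<open>l x > 0\<close>, all terms of this
  sum would have the same sign and one of them would not vanish.\<close>

lemma shatters_rational_halfspaces_compl_card_le:
  assumes "finite A" "shatters (rational_halfspaces_compl d) A"
  shows "card A \<le> d + 1"
proof (rule ccontr)
  assume "\<not> card A \<le> d + 1"
  then obtain l :: "vect \<Rightarrow> real" where l: "\<exists>x\<in>A. l x \<noteq> 0" "(\<Sum>x\<in>A. l x) = 0"
    and lw: "\<And>w. (\<Sum>x\<in>A. l x * dot d x w) = 0"
    using exists_affine_dependence[OF assms(1), of d] by auto
  have l_aff: "(\<Sum>x\<in>A. l x * (dot d x w - b)) = 0" for w b
    using lw[of w] l(2) by (simp add: right_diff_distrib sum_subtractf flip: sum_distrib_right)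
  have neg: "\<exists>x\<in>A. l x < 0"
  proof (rule ccontr)
    assume "\<not> (\<exists>x\<in>A. l x < 0)"
    then have "\<forall>x\<in>A. l x = 0" using l(2) by (subst sum_nonneg_eq_0_iff[OF assms(1), symmetric]) (auto simp: not_less)
    with l(1) show False by blast
  qed
  have pos: "\<exists>x\<in>A. 0 < l x"
  proof (rule ccontr)
    assume "\<not> (\<exists>x\<in>A. 0 < l x)"
    then have "\<forall>x\<in>A. - l x = 0"
      using l(2) by (subst sum_nonneg_eq_0_iff[OF assms(1), symmetric]) (auto simp: not_less sum_negf)
    with l(1) show False by auto
  qed
  obtain f where f: "f \<in> rational_halfspaces_compl d" "\<forall>x\<in>A. f x = 1 \<longleftrightarrow> x \<in> {x\<in>A. 0 < l x}"
    using assms(2) unfolding shatters_def by (metis (no_types, lifting) mem_Collect_eq subsetI)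
  from f(1) obtain w b where "f = halfspace_ind d w b \<or> f = (\<lambda>x. 1 - halfspace_ind d w b x)"
    by (auto simp: rational_halfspaces_compl_def rational_halfspaces_def)
  then show False
  proof
    assume "f = halfspace_ind d w b"
    then have sep: "0 < l x \<longleftrightarrow> 0 \<le> dot d x w - b" if "x \<in> A" for x
      using f(2) that by (auto simp: halfspace_ind_def)
    have "0 < (\<Sum>x\<in>A. l x * (dot d x w - b))"
    proof -
      have "0 \<le> l x * (dot d x w - b)" if "x \<in> A" for x
        using sep[OF that] by (cases "0 < l x") (auto simp: mult_nonpos_nonpos)
      moreover obtain x where "x \<in> A" "l x < 0" using neg by blast
      then have "0 < l x * (dot d x w - b)" using sep by (intro mult_neg_neg) force+
      ultimately show ?thesis using \<open>x \<in> A\<close> assms(1) by (intro sum_pos2[of A x]) auto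
    qed
    then show False using l_aff by simp
  next
    assume "f = (\<lambda>x. 1 - halfspace_ind d w b x)"
    then have "f x = 1 \<longleftrightarrow> dot d x w - b < 0" for x
      by (simp add: halfspace_ind_def not_le)
    then have sep: "0 < l x \<longleftrightarrow> dot d x w - b < 0" if "x \<in> A" for x
      using f(2) that by simp
    have "0 < (\<Sum>x\<in>A. - (l x * (dot d x w - b)))"
    proof -
      have "0 \<le> - (l x * (dot d x w - b))" if "x \<in> A" for x
        using sep[OF that] by (cases "0 < l x") (auto simp: mult_le_0_iff)
      moreover obtain x where "x \<in> A" "0 < l x" using pos by blast
      then have "0 < - (l x * (dot d x w - b))" using sep by (simp add: mult_pos_neg)
      ultimately show ?thesis using \<open>x \<in> A\<close> assms(1) by (intro sum_pos2[of A x]) auto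
    qed
    then show False using l_aff[of w b] by (simp add: sum_negf)
  qed
qed

lemma vc_dim_rational_halfspaces_compl:
  obtains V where "vc_dim d (rational_halfspaces_compl d) = enat V" "V \<le> d + 1"
proof -
  have "vc_dim d (rational_halfspaces_compl d) \<le> enat (d + 1)"
    unfolding vc_dim_def by (intro SUP_least) (auto dest: shatters_rational_halfspaces_compl_card_le)
  then show ?thesis using that by (metis enat_ile enat_ord_simps(1))
qed

section \<open>Uniform deviations over all half-spaces\<close>

lemma dot_measurable [measurable]: "(\<lambda>x. dot d x w) \<in> borel_measurable (euclid d)"
  unfolding dot_def
proof (rule borel_measurable_sum)
  fix j assume "j \<in> {..<d}"
  then have [measurable]: "(\<lambda>x. x j) \<in> borel_measurable (euclid d)"
    by (rule measurable_component_singleton)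
  show "(\<lambda>x. x j * w j) \<in> borel_measurable (euclid d)" by measurable
qed

lemma halfspace_ind_measurable [measurable]: "halfspace_ind d w b \<in> borel_measurable (euclid d)"
proof -
  have "{x \<in> space (euclid d). b \<le> dot d x w} \<in> sets (euclid d)" by measurable
  then have "indicator {x \<in> space (euclid d). b \<le> dot d x w} \<in> borel_measurable (euclid d)"
    by (rule borel_measurable_indicator)
  then show ?thesis
    by (rule measurable_cong[THEN iffD1, rotated]) (auto simp: halfspace_ind_def)
qed

text \<open>Everywhere pointwise convergence needs care on the boundary \<open>\<langle>x, w\<rangle> = b\<close>. The thresholds are
  therefore moved outwards by more than \<open>e\<close> while the normal vectors are perturbed only by \<open>e\<^sup>2\<close>, so that
  boundary points stay inside.\<close>

lemma rational_halfspace_approximation: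
  obtains g where "\<And>n. g n \<in> rational_halfspaces d"
    "\<And>x. (\<lambda>n. g n x) \<longlonglongrightarrow> halfspace_ind d w b x"
proof -
  define e :: "nat \<Rightarrow> real" where "e n = inverse (real (Suc n))" for n
  have e: "0 < e n" "e n \<le> 1" for n by (auto simp: e_def field_simps)
  have e_lim: "e \<longlonglongrightarrow> 0" unfolding e_def by (rule LIMSEQ_inverse_real_of_nat)
  have "\<forall>n j. \<exists>q. \<bar>real_of_rat q - w j\<bar> < (e n)\<^sup>2"
  proof (intro allI)
    fix n j
    obtain q where "w j - (e n)\<^sup>2 < of_rat q" "of_rat q < w j + (e n)\<^sup>2"
      using of_rat_dense[of "w j - (e n)\<^sup>2" "w j + (e n)\<^sup>2"] e(1)[of n] by auto
    then show "\<exists>q. \<bar>real_of_rat q - w j\<bar> < (e n)\<^sup>2" by (intro exI[of _ q]) auto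
  qed
  then obtain q where q: "\<And>j n. \<bar>real_of_rat (q n j) - w j\<bar> < (e n)\<^sup>2" by metis
  have "\<exists>t. b - 2 * e n < real_of_rat t \<and> real_of_rat t < b - e n" for n
    using of_rat_dense[of "b - 2 * e n" "b - e n"] e(1)[of n] by auto
  then obtain t where t: "\<And>n. b - 2 * e n < real_of_rat (t n)" "\<And>n. real_of_rat (t n) < b - e n"
    by metis
  (* The truncated list only has to agree with q n below d. *)
  define wn where "wn n = (\<lambda>j. real_of_rat (map (q n) [0..<d] ! j))" for n
  define g where "g n = halfspace_ind d (wn n) (real_of_rat (t n))" for n
  have g_mem: "g n \<in> rational_halfspaces d" for n
    unfolding g_def wn_def rational_halfspaces_def
    by (rule image_eqI[of _ _ "(map (q n) [0..<d], t n)"]) auto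
  have "(\<lambda>n. g n x) \<longlonglongrightarrow> halfspace_ind d w b x" for x
  proof -
    define s where "s = (\<Sum>j<d. \<bar>x j\<bar>)"
    have s: "0 \<le> s" by (simp add: s_def sum_nonneg)
    have close: "\<bar>dot d x (wn n) - dot d x w\<bar> \<le> (e n)\<^sup>2 * s" for n
    proof -
      have "\<bar>dot d x (wn n) - dot d x w\<bar> = \<bar>\<Sum>j<d. x j * (real_of_rat (q n j) - w j)\<bar>"
        unfolding dot_def wn_def by (simp add: sum_subtractf right_diff_distrib)
      also have "\<dots> \<le> (\<Sum>j<d. \<bar>x j\<bar> * (e n)\<^sup>2)"
        using q[of n, THEN less_imp_le]
        by (intro order.trans[OF sum_abs] sum_mono) (auto simp: abs_mult intro: mult_left_mono)
      finally show ?thesis by (simp add: s_def sum_distrib_left mult.commute)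
    qed
    have "eventually (\<lambda>n. g n x = halfspace_ind d w b x) sequentially"
    proof (cases "b \<le> dot d x w")
      case True
      have "(\<lambda>n. e n * s) \<longlonglongrightarrow> 0 * s" by (intro tendsto_mult e_lim tendsto_const)
      then have "eventually (\<lambda>n. e n * s < 1) sequentially"
        by (rule order_tendstoD(2)) simp
      then show ?thesis
      proof eventually_elim
        case (elim n)
        have "(e n)\<^sup>2 * s \<le> e n * 1"
          unfolding power2_eq_square mult.assoc using elim e(1)[of n] by (intro mult_left_mono) auto
        then have "real_of_rat (t n) \<le> dot d x (wn n)" using close[of n] t(2)[of n] True by linarith
        then show ?case using True by (simp add: g_def halfspace_ind_def)
      qed
    next
      case False
      have "(\<lambda>n. e n * (s + 2)) \<longlonglongrightarrow> 0 * (s + 2)" by (intro tendsto_mult e_lim tendsto_const)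
      then have "eventually (\<lambda>n. e n * (s + 2) < b - dot d x w) sequentially"
        by (rule order_tendstoD(2)) (use False in simp)
      then show ?thesis
      proof eventually_elim
        case (elim n)
        have "(e n)\<^sup>2 * s \<le> e n * s"
          unfolding power2_eq_square using e[of n] s by (intro mult_right_mono) (auto simp: mult_left_le)
        then have "\<not> real_of_rat (t n) \<le> dot d x (wn n)"
          using close[of n] t(1)[of n] elim by (simp add: algebra_simps)
        then show ?case using False by (simp add: g_def halfspace_ind_def)
      qed
    qed
    then show ?thesis by (rule tendsto_eventually)
  qed
  with g_mem show ?thesis using that by blast
qed

text \<open>The inequality for the countable class passes to all half-spaces: both the empirical and, by
  dominated convergence, the expected frequencies are continuous along pointwise limits of
  indicators.\<close>

lemma halfspace_deviation:
  fixes M :: "outcome measure" and Y :: "nat \<Rightarrow> outcome \<Rightarrow> vect"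
  assumes C: "vc_deviation_constant C" and dn: "1 \<le> d" "1 \<le> n" and M: "prob_space M"
    and indep: "prob_space.indep_vars M (\<lambda>_. euclid d) Y {1..n}" and u: "0 < u"
  obtains E where "E \<in> sets M" "1 - exp (- u) \<le> measure M E"
    "\<And>\<omega> w b. \<omega> \<in> E \<Longrightarrow>
       \<bar>(\<Sum>i=1..n. of_bool (b \<le> dot d (Y i \<omega>) w) - measure M {\<omega>\<in>space M. b \<le> dot d (Y i \<omega>) w})\<bar> / real n
       \<le> C * (sqrt ((real d + 1) / real n) + sqrt (u / real n))"
proof -
  interpret prob_space M by (rule M)
  define F where "F = rational_halfspaces_compl d"
  define bound where "bound = C * (sqrt ((real d + 1) / real n) + sqrt (u / real n))"
  define dev where "dev f \<omega> = (\<Sum>i=1..n. f (Y i \<omega>) - (LINT \<omega>'|M. f (Y i \<omega>'))) / real n"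
    for f :: "vect \<Rightarrow> real" and \<omega>
  have Y [measurable]: "Y i \<in> measurable M (euclid d)" if "i \<in> {1..n}" for i
    using indep that by (auto simp: indep_vars_def)
  obtain V where V: "vc_dim d F = enat V" "V \<le> d + 1"
    using vc_dim_rational_halfspaces_compl unfolding F_def by blast
  have "countable F"
    unfolding F_def rational_halfspaces_compl_def rational_halfspaces_def by simp
  moreover have F_ind: "f \<in> borel_measurable (euclid d)" "f x \<in> {0, 1}" if "f \<in> F" for f x
    using that by (auto simp: F_def rational_halfspaces_compl_def rational_halfspaces_def)
      (auto simp: halfspace_ind_def)
  ultimately obtain E where E: "E \<in> sets M" "1 - exp (- u) \<le> measure M E"
    "\<And>\<omega> f. \<omega> \<in> E \<Longrightarrow> f \<in> F \<Longrightarrow>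
       dev f \<omega> \<le> C * (sqrt (real V / real n) + sqrt (u / real n))"
    using C[unfolded vc_deviation_constant_def, THEN conjunct2, rule_format, of d n M Y F V u]
      dn M indep V(1) u unfolding dev_def by blast
  have "0 < C" using C by (simp add: vc_deviation_constant_def)
  then have "C * (sqrt (real V / real n) + sqrt (u / real n)) \<le> bound"
    unfolding bound_def using V(2) by (intro mult_left_mono add_right_mono) (auto intro!: divide_right_mono)
  then have E_F: "dev f \<omega> \<le> bound" if "\<omega> \<in> E" "f \<in> F" for f \<omega>
    using E(3)[OF that] by linarith
  have dev_lim: "(\<lambda>m. dev (g m) \<omega>) \<longlonglongrightarrow> dev f \<omega>"
    if g: "\<And>m. g m \<in> F" and lim: "\<And>x. (\<lambda>m. g m x) \<longlonglongrightarrow> f x" for g f \<omega>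
  proof -
    have "(\<lambda>m. LINT \<omega>'|M. g m (Y i \<omega>')) \<longlonglongrightarrow> (LINT \<omega>'|M. f (Y i \<omega>'))" if i: "i \<in> {1..n}" for i
    proof (rule integral_dominated_convergence[where w="\<lambda>_. 1"])
      have [measurable]: "g m \<in> borel_measurable (euclid d)" for m by (rule F_ind(1)[OF g])
      show gm: "(\<lambda>\<omega>'. g m (Y i \<omega>')) \<in> borel_measurable M" for m
        using Y[OF i] by measurable
      show "(\<lambda>\<omega>'. f (Y i \<omega>')) \<in> borel_measurable M"
        by (rule borel_measurable_LIMSEQ_real[OF _ gm]) (rule lim)
      show "AE x in M. norm (g m (Y i x)) \<le> 1" for m
      proof (rule AE_I2)
        fix x show "norm (g m (Y i x)) \<le> 1" using F_ind(2)[OF g, of m "Y i x"] by auto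
      qed
    qed (auto intro: lim)
    then show ?thesis unfolding dev_def by (intro tendsto_divide tendsto_sum tendsto_diff lim) (use dn in auto)
  qed
  have dev_ind: "\<bar>dev (halfspace_ind d w b) \<omega>\<bar> \<le> bound" if \<omega>: "\<omega> \<in> E" for w b \<omega>
  proof -
    obtain g where g: "\<And>m. g m \<in> rational_halfspaces d"
      "\<And>x. (\<lambda>m. g m x) \<longlonglongrightarrow> halfspace_ind d w b x"
      using rational_halfspace_approximation by blast
    have gF: "g m \<in> F" "(\<lambda>x. 1 - g m x) \<in> F" for m
      using g(1)[of m] by (auto simp: F_def rational_halfspaces_compl_def)
    have "(\<lambda>m. dev (g m) \<omega>) \<longlonglongrightarrow> dev (halfspace_ind d w b) \<omega>"
      by (rule dev_lim) (rule gF(1), rule g(2))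
    then have "dev (halfspace_ind d w b) \<omega> \<le> bound"
      by (rule LIMSEQ_le_const2) (use E_F[OF \<omega> gF(1)] in auto)
    moreover have "(\<lambda>m. dev (\<lambda>x. 1 - g m x) \<omega>) \<longlonglongrightarrow> dev (\<lambda>x. 1 - halfspace_ind d w b x) \<omega>"
      by (rule dev_lim) (rule gF(2), intro tendsto_diff tendsto_const g(2))
    then have "dev (\<lambda>x. 1 - halfspace_ind d w b x) \<omega> \<le> bound"
      by (rule LIMSEQ_le_const2) (use E_F[OF \<omega> gF(2)] in auto)
    moreover have "dev (\<lambda>x. 1 - halfspace_ind d w b x) \<omega> = - dev (halfspace_ind d w b) \<omega>"
    proof -
      have "(LINT \<omega>'|M. 1 - halfspace_ind d w b (Y i \<omega>')) = 1 - (LINT \<omega>'|M. halfspace_ind d w b (Y i \<omega>'))"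
        if i: "i \<in> {1..n}" for i
      proof -
        have "integrable M (\<lambda>\<omega>'. halfspace_ind d w b (Y i \<omega>'))"
          using Y[OF i] by (intro integrable_const_bound[where B=1]) (auto simp: halfspace_ind_def)
        then show ?thesis by (subst Bochner_Integration.integral_diff) (auto simp: prob_space)
      qed
      then have "dev (\<lambda>x. 1 - halfspace_ind d w b x) \<omega> =
          (\<Sum>i=1..n. - (halfspace_ind d w b (Y i \<omega>) - (LINT \<omega>'|M. halfspace_ind d w b (Y i \<omega>')))) / real n"
        unfolding dev_def by (intro arg_cong2[where f="(/)"] sum.cong) auto
      then show ?thesis by (simp only: sum_negf dev_def minus_divide_left)
    qed
    ultimately show ?thesis by linarith
  qed
  have "\<bar>(\<Sum>i=1..n. of_bool (b \<le> dot d (Y i \<omega>) w) - measure M {\<omega>\<in>space M. b \<le> dot d (Y i \<omega>) w})\<bar> / real n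
       \<le> bound" if \<omega>: "\<omega> \<in> E" for \<omega> w b
  proof -
    have "(LINT \<omega>'|M. halfspace_ind d w b (Y i \<omega>')) = measure M {\<omega>\<in>space M. b \<le> dot d (Y i \<omega>) w}"
      if i: "i \<in> {1..n}" for i
    proof -
      have "(LINT \<omega>'|M. halfspace_ind d w b (Y i \<omega>')) =
          (LINT \<omega>'|M. indicator {\<omega>\<in>space M. b \<le> dot d (Y i \<omega>) w} \<omega>')"
        by (intro Bochner_Integration.integral_cong) (auto simp: halfspace_ind_def)
      then show ?thesis by (simp add: Int_def conj_ac)
    qed
    then have "dev (halfspace_ind d w b) \<omega> =
      (\<Sum>i=1..n. of_bool (b \<le> dot d (Y i \<omega>) w) - measure M {\<omega>\<in>space M. b \<le> dot d (Y i \<omega>) w}) / real n"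
      unfolding dev_def by (intro arg_cong2[where f="(/)"] sum.cong) (auto simp: halfspace_ind_def)
    then show ?thesis using dev_ind[OF \<omega>, of w b] by simp
  qed
  with E(1,2) show ?thesis using that unfolding bound_def by blast
qed

section \<open>Empirical medians and quantiles\<close>

definition fraction :: "nat \<Rightarrow> (nat \<Rightarrow> bool) \<Rightarrow> real" where
  "fraction K Q = real (card {k\<in>{1..K}. Q k}) / real K"

lemma sum_of_bool_fraction:
  assumes "1 \<le> K"
  shows "(\<Sum>k=1..K. of_bool (Q k)) = real K * fraction K Q"
proof -
  have "{1..K} \<inter> {k. Q k} = {k\<in>{1..K}. Q k}" by auto
  then show ?thesis using assms by (simp only: fraction_def sum_of_bool_eq finite_atLeastAtMost) simp
qed

lemma fraction_mono: "(\<And>k. k \<in> {1..K} \<Longrightarrow> P k \<Longrightarrow> Q k) \<Longrightarrow> fraction K P \<le> fraction K Q"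
proof -
  assume "\<And>k. k \<in> {1..K} \<Longrightarrow> P k \<Longrightarrow> Q k"
  then have "card {k\<in>{1..K}. P k} \<le> card {k\<in>{1..K}. Q k}" by (intro card_mono) auto
  then show ?thesis unfolding fraction_def by (intro divide_right_mono) auto
qed

lemma fraction_compl: assumes "1 \<le> K" shows "fraction K (\<lambda>k. \<not> P k) = 1 - fraction K P"
proof -
  have "card {k\<in>{1..K}. P k} + card {k\<in>{1..K}. \<not> P k} = card ({k\<in>{1..K}. P k} \<union> {k\<in>{1..K}. \<not> P k})"
    by (rule card_Un_disjoint[symmetric]) auto
  also have "{k\<in>{1..K}. P k} \<union> {k\<in>{1..K}. \<not> P k} = {1..K}" by auto
  finally have "real (card {k\<in>{1..K}. P k}) + real (card {k\<in>{1..K}. \<not> P k}) = real K"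
    by (metis card_atLeastAtMost diff_Suc_1 of_nat_add)
  then show ?thesis using assms unfolding fraction_def by (simp add: field_simps)
qed

lemma fraction_disj_disjoint:
  assumes "\<And>k. k \<in> {1..K} \<Longrightarrow> \<not> (P k \<and> Q k)"
  shows "fraction K (\<lambda>k. P k \<or> Q k) = fraction K P + fraction K Q"
proof -
  have "{k\<in>{1..K}. P k \<or> Q k} = {k\<in>{1..K}. P k} \<union> {k\<in>{1..K}. Q k}" by auto
  moreover have "card ({k\<in>{1..K}. P k} \<union> {k\<in>{1..K}. Q k}) = card {k\<in>{1..K}. P k} + card {k\<in>{1..K}. Q k}"
    using assms by (intro card_Un_disjoint) auto
  ultimately show ?thesis unfolding fraction_def by (simp add: add_divide_distrib)
qed

lemma fraction_disj_le: "fraction K (\<lambda>k. P k \<or> Q k) \<le> fraction K P + fraction K Q"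
proof -
  have "fraction K (\<lambda>k. P k \<or> Q k) = fraction K (\<lambda>k. P k \<or> (Q k \<and> \<not> P k))"
    by (intro arg_cong2[where f=fraction]) auto
  also have "\<dots> = fraction K P + fraction K (\<lambda>k. Q k \<and> \<not> P k)"
    by (rule fraction_disj_disjoint) auto
  also have "fraction K (\<lambda>k. Q k \<and> \<not> P k) \<le> fraction K Q" by (rule fraction_mono) auto
  finally show ?thesis by simp
qed

lemma fraction_conj_ge:
  assumes "1 \<le> K"
  shows "fraction K P + fraction K Q - 1 \<le> fraction K (\<lambda>k. P k \<and> Q k)"
  using fraction_disj_le[of K "\<lambda>k. \<not> P k" "\<lambda>k. \<not> Q k"] fraction_compl[OF assms, of P]
    fraction_compl[OF assms, of Q] fraction_compl[OF assms, of "\<lambda>k. P k \<and> Q k"] by simp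

lemma length_filter_sort_map:
  "length (filter P (sort (map a [1..<Suc K]))) = card {k\<in>{1..K}. P (a k)}"
proof -
  have "length (filter P (sort (map a [1..<Suc K]))) = size (filter_mset P (mset (map a [1..<Suc K])))"
    by (metis mset_filter mset_sort size_mset)
  also have "\<dots> = length (filter (P \<circ> a) [1..<Suc K])"
    by (metis filter_map length_map mset_filter size_mset)
  also have "\<dots> = card (set (filter (P \<circ> a) [1..<Suc K]))"
    by (rule distinct_card[symmetric]) simp
  also have "set (filter (P \<circ> a) [1..<Suc K]) = {k\<in>{1..K}. P (a k)}" by auto
  finally show ?thesis .
qed

text \<open>For even \<open>K\<close> the median is the midpoint of the order statistics number \<open>K div 2 - 1\<close> and
  \<open>K div 2\<close> (counted from 0), for odd \<open>K\<close> both indices below are the middle one.\<close>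

lemma Med_between_middle:
  assumes "1 \<le> K" and ys: "ys = sort (map a [1..<Suc K])"
  shows "ys ! ((K - 1) div 2) \<le> Med K a" "Med K a \<le> ys ! (K div 2)"
proof -
  have len: "length ys = K" by (simp add: ys)
  have le: "ys ! ((K - 1) div 2) \<le> ys ! (K div 2)"
    using assms(1) by (intro sorted_nth_mono) (auto simp: len ys)
  have Med: "Med K a = (if odd K then ys ! (K div 2) else (ys ! (K div 2 - 1) + ys ! (K div 2)) / 2)"
    by (simp add: Med_def emp_median_def Let_def ys)
  have "(K - 1) div 2 = (if odd K then K div 2 else K div 2 - 1)"
    using assms(1) by (auto elim!: oddE evenE)
  with le show "ys ! ((K - 1) div 2) \<le> Med K a" "Med K a \<le> ys ! (K div 2)"
    unfolding Med by (auto split: if_splits)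
qed

text \<open>The majority is strict because, for even \<open>K\<close>, exactly half of the values would leave the lower of
  the two middle order statistics outside \<open>P\<close>.\<close>

lemma Med_majority_up:
  assumes "1 / 2 < fraction K (\<lambda>k. P (a k))" and up: "\<And>x y. x \<le> y \<Longrightarrow> P x \<Longrightarrow> P y"
  shows "P (Med K a)"
proof -
  have K: "1 \<le> K" using assms(1) by (cases K) (auto simp: fraction_def)
  define ys where "ys = sort (map a [1..<Suc K])"
  have len: "length ys = K" and srt: "sorted ys" by (simp_all add: ys_def)
  have "P (ys ! ((K - 1) div 2))"
  proof (rule ccontr)
    assume no: "\<not> P (ys ! ((K - 1) div 2))"
    have "card {i. i < length ys \<and> P (ys ! i)} \<le> card {(K - 1) div 2<..<K}"
    proof (intro card_mono subsetI)
      fix i assume i: "i \<in> {i. i < length ys \<and> P (ys ! i)}"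
      have "\<not> i \<le> (K - 1) div 2"
      proof
        assume "i \<le> (K - 1) div 2"
        then have "ys ! i \<le> ys ! ((K - 1) div 2)" using K by (intro sorted_nth_mono srt) (auto simp: len)
        then show False using i no up by blast
      qed
      then show "i \<in> {(K - 1) div 2<..<K}" using i by (simp add: len)
    qed simp
    then have "length (filter P ys) \<le> K - Suc ((K - 1) div 2)"
      by (simp add: length_filter_conv_card)
    also have "2 * (K - Suc ((K - 1) div 2)) \<le> K" by linarith
    finally have "2 * length (filter P ys) \<le> K" by simp
    then have "2 * card {k\<in>{1..K}. P (a k)} \<le> K" unfolding ys_def length_filter_sort_map .
    then have "2 * real (card {k\<in>{1..K}. P (a k)}) \<le> real K" by linarith
    then show False using assms(1) K by (simp add: fraction_def field_simps)
  qed
  then show ?thesis using Med_between_middle(1)[OF K ys_def] up by blast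
qed

lemma Med_majority_down:
  assumes "1 / 2 < fraction K (\<lambda>k. P (a k))" and down: "\<And>x y. x \<le> y \<Longrightarrow> P y \<Longrightarrow> P x"
  shows "P (Med K a)"
proof -
  have K: "1 \<le> K" using assms(1) by (cases K) (auto simp: fraction_def)
  define ys where "ys = sort (map a [1..<Suc K])"
  have len: "length ys = K" and srt: "sorted ys" by (simp_all add: ys_def)
  have "P (ys ! (K div 2))"
  proof (rule ccontr)
    assume no: "\<not> P (ys ! (K div 2))"
    have "card {i. i < length ys \<and> P (ys ! i)} \<le> card {..<K div 2}"
    proof (intro card_mono subsetI)
      fix i assume i: "i \<in> {i. i < length ys \<and> P (ys ! i)}"
      have "\<not> K div 2 \<le> i"
      proof
        assume "K div 2 \<le> i"
        then have "ys ! (K div 2) \<le> ys ! i" using i by (intro sorted_nth_mono srt) auto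
        then show False using i no down by blast
      qed
      then show "i \<in> {..<K div 2}" by simp
    qed simp
    then have "2 * length (filter P ys) \<le> K" by (simp add: length_filter_conv_card)
    then have "2 * card {k\<in>{1..K}. P (a k)} \<le> K" unfolding ys_def length_filter_sort_map .
    then have "2 * real (card {k\<in>{1..K}. P (a k)}) \<le> real K" by linarith
    then show False using assms(1) K by (simp add: fraction_def field_simps)
  qed
  then show ?thesis using Med_between_middle(2)[OF K ys_def] down by blast
qed

lemma Med_geI: "1 / 2 < fraction K (\<lambda>k. t \<le> a k) \<Longrightarrow> t \<le> Med K a"
  by (rule Med_majority_up[where P="\<lambda>x. t \<le> x"]) auto

lemma Med_gtI: "1 / 2 < fraction K (\<lambda>k. t < a k) \<Longrightarrow> t < Med K a"
  by (rule Med_majority_up[where P="\<lambda>x. t < x"]) auto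

lemma Med_leI: "1 / 2 < fraction K (\<lambda>k. a k \<le> t) \<Longrightarrow> Med K a \<le> t"
  by (rule Med_majority_down[where P="\<lambda>x. x \<le> t"]) auto

lemma Med_ltI: "1 / 2 < fraction K (\<lambda>k. a k < t) \<Longrightarrow> Med K a < t"
  by (rule Med_majority_down[where P="\<lambda>x. x < t"]) auto

lemma Med_affine:
  assumes "0 \<le> c" "1 \<le> K"
  shows "Med K (\<lambda>k. e + c * a k) = e + c * Med K a"
proof -
  have mono: "mono (\<lambda>x. e + c * x)" using assms(1) by (auto intro!: monoI mult_left_mono)
  have "sort (map (\<lambda>k. e + c * a k) [1..<Suc K]) = map (\<lambda>x. e + c * x) (sort (map a [1..<Suc K]))"
    (is "_ = map ?f ?ys")
  proof (rule properties_for_sort)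
    show "mset (map ?f ?ys) = mset (map (\<lambda>k. e + c * a k) [1..<Suc K])"
      unfolding mset_map mset_sort by (simp add: multiset.map_comp comp_def)
    show "sorted (map ?f ?ys)"
      unfolding sorted_map by (rule sorted_wrt_mono_rel[OF _ sorted_sort]) (rule monoD[OF mono])
  qed
  then show ?thesis
    unfolding Med_def emp_median_def Let_def using assms(2)
    by (simp add: field_simps)
qed

text \<open>Up to reflection \<open>H\<close> is the distribution function of \<open>- Z\<close>. Right continuity of the latter makes
  \<open>{t. p \<le> H t}\<close> closed at its supremum, so that the greatest element in the definition of
  \<open>W_quantile\<close> exists.\<close>

lemma (in prob_space) W_quantile_props:
  assumes Z [measurable]: "Z \<in> borel_measurable M" and p: "0 < p" "p < 1"
    and H: "H = (\<lambda>t. prob {\<omega>\<in>space M. t \<le> Z \<omega>})"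
  shows "p \<le> H (W_quantile H p)" and "W_quantile H p < t \<Longrightarrow> H t < p"
proof -
  define D where "D = distr M borel (\<lambda>\<omega>. - Z \<omega>)"
  interpret D: real_distribution D unfolding D_def by (rule real_distribution_distr) simp
  have HD: "H t = cdf D (- t)" for t
    unfolding H cdf_def D_def by (subst measure_distr) (auto intro!: arg_cong[where f=prob])
  define A where "A = {t. p \<le> H t}"
  have "eventually (\<lambda>x. p < cdf D x) at_top"
    using D.cdf_lim_at_top_prob p(2) by (rule order_tendstoD(1))
  then obtain x where "p < cdf D x" by (auto simp: eventually_at_top_linorder)
  then have "- x \<in> A" by (simp add: A_def HD)
  then have A_ne: "A \<noteq> {}" by blast
  have "eventually (\<lambda>x. cdf D x < p) at_bot"
    using D.cdf_lim_at_bot p(1) by (rule order_tendstoD(2))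
  then obtain y where y: "\<And>x. x \<le> y \<Longrightarrow> cdf D x < p" by (auto simp: eventually_at_bot_linorder)
  have "t \<le> - y" if "t \<in> A" for t
    using y[of "- t"] that by (force simp: A_def HD)
  then have bdd: "bdd_above A" by (auto simp: bdd_above_def)
  have Sup_mem: "p \<le> H (Sup A)"
  proof (rule ccontr)
    assume "\<not> p \<le> H (Sup A)"
    then have less: "cdf D (- Sup A) < p" by (simp add: HD)
    have "(cdf D \<longlongrightarrow> cdf D (- Sup A)) (at_right (- Sup A))"
      using D.cdf_is_right_cont by (simp add: continuous_within)
    then have "eventually (\<lambda>x. cdf D x < p) (at_right (- Sup A))"
      using less by (rule order_tendstoD(2))
    then obtain b where b: "- Sup A < b" "\<And>x. - Sup A < x \<Longrightarrow> x < b \<Longrightarrow> cdf D x < p"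
      by (auto simp: eventually_at_right_field)
    obtain t where t: "t \<in> A" "- b < t" using less_cSup_iff[OF A_ne bdd, of "- b"] b(1) by auto
    have "t \<le> Sup A" using t(1) bdd by (rule cSup_upper)
    then have "cdf D (- t) < p" using less b(2)[of "- t"] t(2) by (cases "t = Sup A") auto
    then show False using t(1) by (simp add: A_def HD)
  qed
  have W: "W_quantile H p = Sup A"
    unfolding W_quantile_def using Sup_mem bdd
    by (intro Greatest_equality) (auto simp: A_def intro: cSup_upper)
  show "p \<le> H (W_quantile H p)" using Sup_mem W by simp
  show "H t < p" if "W_quantile H p < t"
    using that bdd cSup_upper[of t A] unfolding W by (force simp: A_def)
qed

text \<open>\<open>H\<close> may jump at \<open>w\<close>, so the bound on the values strictly above \<open>w\<close> is read off at the smallest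
  of them.\<close>

lemma fraction_quantile_bounds:
  fixes z :: "nat \<Rightarrow> real"
  assumes close: "\<And>t. \<bar>fraction K (\<lambda>k. t \<le> z k) - H t\<bar> < \<delta>"
    and W: "p \<le> H w" "\<And>t. w < t \<Longrightarrow> H t < p" and "0 \<le> p"
  shows "p - \<delta> < fraction K (\<lambda>k. w \<le> z k)" "fraction K (\<lambda>k. w < z k) < p + \<delta>"
proof -
  show "p - \<delta> < fraction K (\<lambda>k. w \<le> z k)" using close[of w] W(1) by linarith
  define T where "T = z ` {k\<in>{1..K}. w < z k}"
  show "fraction K (\<lambda>k. w < z k) < p + \<delta>"
  proof (cases "T = {}")
    case True
    then have "{k\<in>{1..K}. w < z k} = {}" by (simp add: T_def)
    then have "fraction K (\<lambda>k. w < z k) = 0" unfolding fraction_def by (simp only:) simp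
    moreover have "0 < \<delta>" using close[of w] by linarith
    ultimately show ?thesis using \<open>0 \<le> p\<close> by linarith
  next
    case False
    have "finite T" by (simp add: T_def)
    then have "Min T \<in> T" using False by (rule Min_in)
    then have "w < Min T" by (auto simp: T_def)
    have "fraction K (\<lambda>k. w < z k) \<le> fraction K (\<lambda>k. Min T \<le> z k)"
      using \<open>finite T\<close> by (intro fraction_mono) (auto simp: T_def)
    then show ?thesis using close[of "Min T"] W(2)[OF \<open>w < Min T\<close>] by linarith
  qed
qed

text \<open>The bounds on \<open>H\<close> place the median \<open>q\<close> between \<open>W (1/2 + 2 * \<epsilon>)\<close> and \<open>W (1/2 - 2 * \<epsilon>)\<close>. More
  than a quarter of the values lie on each side of \<open>q\<close> at distance at least \<open>\<phi>l\<close>, and fewer than a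
  quarter on each side lie further away than \<open>\<phi>u\<close>.\<close>

lemma MAD_bounds:
  fixes z :: "nat \<Rightarrow> real" and W H :: "real \<Rightarrow> real"
  assumes K: "1 \<le> K" and e: "0 < \<epsilon>" "\<epsilon> < 1/8"
    and close: "\<And>t. \<bar>fraction K (\<lambda>k. t \<le> z k) - H t\<bar> < 2 * \<epsilon>"
    and W: "\<And>p. 0 < p \<Longrightarrow> p < 1 \<Longrightarrow> p \<le> H (W p)"
      "\<And>p t. 0 < p \<Longrightarrow> p < 1 \<Longrightarrow> W p < t \<Longrightarrow> H t < p"
    and l0: "0 < \<phi>l"
    and up: "max (W (1/4 - 2*\<epsilon>) - W (1/2 + 2*\<epsilon>)) (W (1/2 - 2*\<epsilon>) - W (3/4 + 2*\<epsilon>)) \<le> \<phi>u"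
    and lo: "min (W (1/4 + 2*\<epsilon>) - W (1/2 - 2*\<epsilon>)) (W (1/2 + 2*\<epsilon>) - W (3/4 - 2*\<epsilon>)) \<ge> \<phi>l"
  shows "\<phi>l \<le> Med K (\<lambda>k. \<bar>z k - Med K z\<bar>)" "Med K (\<lambda>k. \<bar>z k - Med K z\<bar>) \<le> \<phi>u"
proof -
  have ge: "p - 2 * \<epsilon> < fraction K (\<lambda>k. W p \<le> z k)" and gt: "fraction K (\<lambda>k. W p < z k) < p + 2 * \<epsilon>"
    if "0 < p" "p < 1" for p
    using fraction_quantile_bounds[OF close W(1)[OF that] W(2)[OF that]] that by auto
  have lt: "1 - p - 2 * \<epsilon> < fraction K (\<lambda>k. z k \<le> W p)" if "0 < p" "p < 1" for p
    using gt[OF that] fraction_compl[OF K, of "\<lambda>k. W p < z k"] by (simp add: not_less)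
  define q where "q = Med K z"
  have q_ge: "W (1/2 + 2*\<epsilon>) \<le> q"
    unfolding q_def using ge[of "1/2 + 2*\<epsilon>"] e by (intro Med_geI) auto
  have q_le: "q \<le> W (1/2 - 2*\<epsilon>)"
    unfolding q_def using lt[of "1/2 - 2*\<epsilon>"] e by (intro Med_leI) auto
  have "1 / 2 < fraction K (\<lambda>k. \<phi>l \<le> \<bar>z k - q\<bar>)"
  proof -
    have "1/2 < fraction K (\<lambda>k. W (1/4 + 2*\<epsilon>) \<le> z k) + fraction K (\<lambda>k. z k \<le> W (3/4 - 2*\<epsilon>))"
      using ge[of "1/4 + 2*\<epsilon>"] lt[of "3/4 - 2*\<epsilon>"] e by auto
    also have "\<dots> = fraction K (\<lambda>k. W (1/4 + 2*\<epsilon>) \<le> z k \<or> z k \<le> W (3/4 - 2*\<epsilon>))"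
      using lo l0 q_ge q_le by (intro fraction_disj_disjoint[symmetric]) auto
    also have "\<dots> \<le> fraction K (\<lambda>k. \<phi>l \<le> \<bar>z k - q\<bar>)"
      using lo q_ge q_le by (intro fraction_mono) auto
    finally show ?thesis .
  qed
  then show "\<phi>l \<le> Med K (\<lambda>k. \<bar>z k - Med K z\<bar>)"
    unfolding q_def by (rule Med_geI)
  have "1 / 2 < fraction K (\<lambda>k. \<bar>z k - q\<bar> \<le> \<phi>u)"
  proof -
    have "1/2 < fraction K (\<lambda>k. W (3/4 + 2*\<epsilon>) \<le> z k) + fraction K (\<lambda>k. z k \<le> W (1/4 - 2*\<epsilon>)) - 1"
      using ge[of "3/4 + 2*\<epsilon>"] lt[of "1/4 - 2*\<epsilon>"] e by auto
    also have "\<dots> \<le> fraction K (\<lambda>k. W (3/4 + 2*\<epsilon>) \<le> z k \<and> z k \<le> W (1/4 - 2*\<epsilon>))"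
      by (rule fraction_conj_ge[OF K])
    also have "\<dots> \<le> fraction K (\<lambda>k. \<bar>z k - q\<bar> \<le> \<phi>u)"
      using up q_ge q_le by (intro fraction_mono) auto
    finally show ?thesis .
  qed
  then show "Med K (\<lambda>k. \<bar>z k - Med K z\<bar>) \<le> \<phi>u"
    unfolding q_def by (rule Med_leI)
qed
section \<open>The outlyingness in standardized coordinates\<close>

lemma dot_cong: "(\<And>j. j < d \<Longrightarrow> x j = x' j) \<Longrightarrow> (\<And>j. j < d \<Longrightarrow> y j = y' j) \<Longrightarrow> dot d x y = dot d x' y'"
  unfolding dot_def by (intro sum.cong) auto

lemma dot_diff_left: "dot d (\<lambda>j. x j - y j) v = dot d x v - dot d y v"
  by (simp add: dot_def left_diff_distrib sum_subtractf)

lemma dot_scale_right: "dot d x (\<lambda>j. c * v j) = c * dot d x v"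
  by (simp add: dot_def sum_distrib_left mult_ac)

lemma dot_self: "dot d x x = (norm2 d x)\<^sup>2"
  by (simp add: dot_def L2_set_def sum_nonneg power2_eq_square)

lemma abs_dot_le: "\<bar>dot d x y\<bar> \<le> norm2 d x * norm2 d y"
proof -
  have "\<bar>dot d x y\<bar> \<le> (\<Sum>j<d. \<bar>x j\<bar> * \<bar>y j\<bar>)"
    unfolding dot_def by (rule order.trans[OF sum_abs]) (simp add: abs_mult)
  also have "\<dots> \<le> norm2 d x * norm2 d y" by (rule L2_set_mult_ineq)
  finally show ?thesis .
qed

lemma norm2_scale: "0 \<le> c \<Longrightarrow> norm2 d (\<lambda>j. c * x j) = c * norm2 d x"
  by (rule L2_set_right_distrib[symmetric])

lemma norm2_eq_0_iff: "norm2 d x = 0 \<longleftrightarrow> (\<forall>j<d. x j = 0)"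
  by (auto simp: L2_set_eq_0_iff)

lemma dot_mat_vec_symmetric:
  assumes "\<forall>i<d. \<forall>j<d. S i j = S j i"
  shows "dot d (mat_vec d S x) y = dot d x (mat_vec d S y)"
proof -
  have "dot d (mat_vec d S x) y = (\<Sum>i<d. \<Sum>j<d. x j * (S j i * y i))"
    unfolding dot_def mat_vec_def sum_distrib_right using assms by (intro sum.cong refl) auto
  also have "\<dots> = dot d x (mat_vec d S y)"
    unfolding dot_def mat_vec_def sum_distrib_left by (rule sum.swap)
  finally show ?thesis .
qed

lemma mat_vec_scale: "mat_vec d S (\<lambda>j. c * x j) i = c * mat_vec d S x i"
  by (simp add: mat_vec_def sum_distrib_left mult_ac)

lemma mat_vec_mat_mul: "mat_vec d (mat_mul d A B) x i = mat_vec d A (mat_vec d B x) i"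
proof -
  have "mat_vec d (mat_mul d A B) x i = (\<Sum>l<d. \<Sum>j<d. A i j * B j l * x l)"
    by (simp add: mat_vec_def mat_mul_def sum_distrib_right)
  also have "\<dots> = (\<Sum>j<d. \<Sum>l<d. A i j * B j l * x l)" by (rule sum.swap)
  finally show ?thesis by (simp add: mat_vec_def sum_distrib_left mult.assoc)
qed

lemma mat_vec_identity:
  assumes "\<And>l. l < d \<Longrightarrow> A i l = of_bool (i = l)" "i < d"
  shows "mat_vec d A x i = x i"
proof -
  have "mat_vec d A x i = (\<Sum>l<d. if i = l then x l else 0)"
    unfolding mat_vec_def using assms(1) by (intro sum.cong) auto
  then show ?thesis using assms(2) by simp
qed

lemma mat_vec_eq_0:
  assumes "\<And>j. j < d \<Longrightarrow> x j = 0"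
  shows "mat_vec d A x i = 0"
  using assms by (simp add: mat_vec_def)

lemma inv_sqrt_mat_nonzero:
  assumes S: "inv_sqrt_mat d Sg S" and v: "norm2 d v \<noteq> 0"
  shows "\<exists>j<d. mat_vec d S v j \<noteq> 0"
proof (rule ccontr)
  assume "\<not> (\<exists>j<d. mat_vec d S v j \<noteq> 0)"
  then have 0: "mat_vec d S v j = 0" if "j < d" for j using that by blast
  have "v i = 0" if i: "i < d" for i
  proof -
    have "v i = mat_vec d (mat_mul d Sg (mat_mul d S S)) v i"
      using S i by (intro mat_vec_identity[symmetric]) (auto simp: inv_sqrt_mat_def inverse_mat_def)
    also have "\<dots> = 0"
      unfolding mat_vec_mat_mul by (intro mat_vec_eq_0 0) (simp add: mat_vec_mat_mul mat_vec_eq_0 0)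
    finally show ?thesis .
  qed
  then show False using v by (simp add: norm2_eq_0_iff)
qed

text \<open>\<open>w = S (S (Sg w))\<close> shows that every direction is in the range of \<open>S\<close>.\<close>

lemma inv_sqrt_mat_direction:
  assumes S: "inv_sqrt_mat d Sg S" and w: "\<exists>j<d. w j \<noteq> 0"
  obtains c v where "0 < c" "norm2 d v = 1" "\<And>j. j < d \<Longrightarrow> w j = c * mat_vec d S v j"
proof -
  define y where "y = mat_vec d S (mat_vec d Sg w)"
  have w_eq: "w j = mat_vec d S y j" if j: "j < d" for j
  proof -
    have "w j = mat_vec d (mat_mul d (mat_mul d S S) Sg) w j"
      using S j by (intro mat_vec_identity[symmetric]) (auto simp: inv_sqrt_mat_def inverse_mat_def)
    then show ?thesis by (simp add: mat_vec_mat_mul y_def)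
  qed
  have "norm2 d y \<noteq> 0"
  proof
    assume "norm2 d y = 0"
    then have "mat_vec d S y j = 0" for j by (intro mat_vec_eq_0) (simp add: norm2_eq_0_iff)
    with w_eq w show False by auto
  qed
  then have pos: "0 < norm2 d y" using L2_set_nonneg[of y "{..<d}"] by linarith
  define v where "v = (\<lambda>j. inverse (norm2 d y) * y j)"
  show ?thesis
  proof (rule that[OF pos])
    show "norm2 d v = 1" using pos unfolding v_def by (subst norm2_scale) auto
    show "w j = norm2 d y * mat_vec d S v j" if "j < d" for j
      unfolding v_def mat_vec_scale using w_eq[OF that] pos by simp
  qed
qed

text \<open>The factor \<open>sqrt n\<close> turns the mean of \<open>n\<close> standardized vectors into the normalized sum that
  \<open>std_tail\<close> uses; the symmetric matrix is moved to the direction \<open>v\<close>, so that half-spaces in terms of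
  \<open>std_coord\<close> are half-spaces for the block means \<open>b\<close> themselves.\<close>

definition std_coord :: "nat \<Rightarrow> matr \<Rightarrow> vect \<Rightarrow> nat \<Rightarrow> vect \<Rightarrow> vect \<Rightarrow> real" where
  "std_coord d S mu n v b = sqrt (real n) * dot d (\<lambda>j. b j - mu j) (mat_vec d S v)"

lemma dot_block_mean:
  "dot d (block_mean I x) w = (\<Sum>i\<in>I. dot d (x i) w) / real (card I)"
proof -
  have "dot d (block_mean I x) w = (\<Sum>j<d. \<Sum>i\<in>I. x i j * w j) / real (card I)"
    by (simp add: dot_def block_mean_def sum_distrib_right sum_divide_distrib)
  also have "(\<Sum>j<d. \<Sum>i\<in>I. x i j * w j) = (\<Sum>i\<in>I. dot d (x i) w)"
    unfolding dot_def by (rule sum.swap)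
  finally show ?thesis .
qed

lemma std_coord_block_mean:
  assumes S: "\<forall>i<d. \<forall>j<d. S i j = S j i" and "0 < card I"
  shows "1 / sqrt (real (card I)) * (\<Sum>i\<in>I. dot d (mat_vec d S (\<lambda>j. x i j - mu j)) v)
    = std_coord d S mu (card I) v (block_mean I x)"
proof -
  have "(\<Sum>i\<in>I. dot d (mat_vec d S (\<lambda>j. x i j - mu j)) v)
      = (\<Sum>i\<in>I. dot d (x i) (mat_vec d S v)) - real (card I) * dot d mu (mat_vec d S v)"
    by (simp add: dot_mat_vec_symmetric[OF S] dot_diff_left sum_subtractf)
  also have "\<dots> = real (card I) * dot d (\<lambda>j. block_mean I x j - mu j) (mat_vec d S v)"
    using assms(2) by (simp add: dot_diff_left dot_block_mean right_diff_distrib)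
  finally have "1 / sqrt (real (card I)) * (\<Sum>i\<in>I. dot d (mat_vec d S (\<lambda>j. x i j - mu j)) v)
      = (real (card I) / sqrt (real (card I))) * dot d (\<lambda>j. block_mean I x j - mu j) (mat_vec d S v)"
    by simp
  then show ?thesis using assms(2) by (simp add: std_coord_def real_div_sqrt)
qed

text \<open>Along \<open>w\<close> all quantities are images of their standardized counterparts under one increasing affine
  map of slope \<open>h = c / sqrt n\<close>, which cancels in the ratio.\<close>

lemma SDO_direction_ratio:
  assumes S: "\<forall>i<d. \<forall>j<d. S i j = S j i"
    and w: "\<And>j. j < d \<Longrightarrow> w j = c * mat_vec d S v j" and c: "0 < c" and n: "0 < n" and K: "1 \<le> K"
    and mad: "Med K (\<lambda>k. \<bar>std_coord d S mu n v (y k) - Med K (\<lambda>k. std_coord d S mu n v (y k))\<bar>) > 0"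
  shows "(let a = (\<lambda>k. dot d (y k) w) in
       ereal \<bar>dot d nu w - Med K a\<bar> / ereal (Med K (\<lambda>k. \<bar>a k - Med K a\<bar>)))
    = (let z = (\<lambda>k. std_coord d S mu n v (y k)) in
       ereal (\<bar>sqrt (real n) * dot d (mat_vec d S (\<lambda>j. nu j - mu j)) v - Med K z\<bar>
         / Med K (\<lambda>k. \<bar>z k - Med K z\<bar>)))"
proof -
  define z where "z = (\<lambda>k. std_coord d S mu n v (y k))"
  define a where "a = (\<lambda>k. dot d (y k) w)"
  define h where "h = c / sqrt (real n)"
  define mad where "mad = Med K (\<lambda>k. \<bar>z k - Med K z\<bar>)"
  have h: "0 < h" "h * sqrt (real n) = c" using c n by (auto simp: h_def)
  have dw: "dot d x w = c * dot d x (mat_vec d S v)" for x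
    by (simp add: dot_cong[of d x x w "\<lambda>j. c * mat_vec d S v j"] w dot_scale_right)
  have a: "a = (\<lambda>k. dot d mu w + h * z k)"
    unfolding a_def z_def std_coord_def dw mult.assoc[symmetric] h(2)
    by (simp add: dot_diff_left algebra_simps)
  have Ma: "Med K a = dot d mu w + h * Med K z"
    unfolding a by (rule Med_affine) (use h K in auto)
  have "(\<lambda>k. \<bar>a k - Med K a\<bar>) = (\<lambda>k. 0 + h * \<bar>z k - Med K z\<bar>)"
    unfolding Ma using h(1) by (auto simp: a abs_mult simp flip: right_diff_distrib)
  then have MADa: "Med K (\<lambda>k. \<bar>a k - Med K a\<bar>) = h * mad"
    using Med_affine[of h K 0 "\<lambda>k. \<bar>z k - Med K z\<bar>"] h(1) K by (simp add: mad_def)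
  have "dot d nu w - dot d mu w = h * (sqrt (real n) * dot d (mat_vec d S (\<lambda>j. nu j - mu j)) v)"
    unfolding mult.assoc[symmetric] h(2) dot_mat_vec_symmetric[OF S] dot_diff_left dw
    by (simp add: right_diff_distrib)
  then have "\<bar>dot d nu w - Med K a\<bar>
      = h * \<bar>sqrt (real n) * dot d (mat_vec d S (\<lambda>j. nu j - mu j)) v - Med K z\<bar>"
    unfolding Ma using h(1) by (simp add: abs_mult flip: right_diff_distrib diff_diff_eq)
  moreover have "0 < mad" using assms(6) by (simp add: mad_def z_def)
  ultimately show ?thesis
    unfolding Let_def a_def[symmetric] z_def[symmetric] MADa mad_def[symmetric]
    using h(1) by simp
qed

lemma SDO_eq_SUP_unit:
  fixes x :: "nat \<Rightarrow> vect" and B :: "nat \<Rightarrow> nat set" and mu :: vect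
  assumes S: "inv_sqrt_mat d Sg S" and n: "0 < n" and K: "1 \<le> K"
  defines "z \<equiv> \<lambda>v k. std_coord d S mu n v (block_mean (B k) x)"
  assumes mad: "\<And>v. norm2 d v = 1 \<Longrightarrow> 0 < Med K (\<lambda>k. \<bar>z v k - Med K (z v)\<bar>)"
  shows "SDO d K B x nu = (SUP v\<in>{v. norm2 d v = 1}.
    ereal (\<bar>sqrt (real n) * dot d (mat_vec d S (\<lambda>j. nu j - mu j)) v - Med K (z v)\<bar>
         / Med K (\<lambda>k. \<bar>z v k - Med K (z v)\<bar>)))"
proof -
  have sym: "\<forall>i<d. \<forall>j<d. S i j = S j i" using S by (simp add: inv_sqrt_mat_def)
  have ratio: "(let a = (\<lambda>k. dot d (block_mean (B k) x) w) in
        ereal \<bar>dot d nu w - Med K a\<bar> / ereal (Med K (\<lambda>k. \<bar>a k - Med K a\<bar>)))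
      = ereal (\<bar>sqrt (real n) * dot d (mat_vec d S (\<lambda>j. nu j - mu j)) v - Med K (z v)\<bar>
         / Med K (\<lambda>k. \<bar>z v k - Med K (z v)\<bar>))"
    if "\<And>j. j < d \<Longrightarrow> w j = c * mat_vec d S v j" "0 < c" "norm2 d v = 1" for w v :: vect and c
    using SDO_direction_ratio[OF sym that(1,2) n K, of mu "\<lambda>k. block_mean (B k) x" nu] mad[OF that(3)]
    unfolding z_def Let_def by blast
  show ?thesis
    unfolding SDO_def
  proof (rule SUP_eq)
    fix w :: vect assume "w \<in> {v. \<exists>j<d. v j \<noteq> 0}"
    then have "\<exists>j<d. w j \<noteq> 0" by simp
    then obtain c v where cv: "0 < c" "norm2 d v = 1" "\<And>j. j < d \<Longrightarrow> w j = c * mat_vec d S v j"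
      using inv_sqrt_mat_direction[OF S] by metis
    then show "\<exists>v\<in>{v. norm2 d v = 1}. (let a = (\<lambda>k. dot d (block_mean (B k) x) w) in
        ereal \<bar>dot d nu w - Med K a\<bar> / ereal (Med K (\<lambda>k. \<bar>a k - Med K a\<bar>)))
      \<le> ereal (\<bar>sqrt (real n) * dot d (mat_vec d S (\<lambda>j. nu j - mu j)) v - Med K (z v)\<bar>
         / Med K (\<lambda>k. \<bar>z v k - Med K (z v)\<bar>))"
      by (intro bexI[of _ v] eq_refl ratio[OF cv(3,1,2)]) (simp_all add: cv)
  next
    fix v assume v: "v \<in> {v. norm2 d v = 1}"
    then show "\<exists>w\<in>{v. \<exists>j<d. v j \<noteq> 0}.
      ereal (\<bar>sqrt (real n) * dot d (mat_vec d S (\<lambda>j. nu j - mu j)) v - Med K (z v)\<bar>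
         / Med K (\<lambda>k. \<bar>z v k - Med K (z v)\<bar>)) \<le> (let a = (\<lambda>k. dot d (block_mean (B k) x) w) in
        ereal \<bar>dot d nu w - Med K a\<bar> / ereal (Med K (\<lambda>k. \<bar>a k - Med K a\<bar>)))"
      using ratio[of "mat_vec d S v" 1 v] inv_sqrt_mat_nonzero[OF S, of v]
      by (intro bexI[of _ "mat_vec d S v"]) auto
  qed
qed

text \<open>The two bounds come from the Cauchy-Schwarz inequality in every direction and from its equality case
  \<open>v = \<eta> / |\<eta>|\<close>; here \<open>\<eta> \<noteq> 0\<close> because \<open>r > |Med| \<ge> 0\<close>.\<close>

lemma SDO_bounds:
  fixes x :: "nat \<Rightarrow> vect" and B :: "nat \<Rightarrow> nat set" and mu nu :: vect
  assumes S: "inv_sqrt_mat d Sg S" and n: "0 < n" and K: "1 \<le> K" and \<phi>: "0 < \<phi>l" "0 < \<phi>u" and d: "1 \<le> d"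
  defines "z \<equiv> \<lambda>v k. std_coord d S mu n v (block_mean (B k) x)"
  assumes med: "\<And>v. norm2 d v = 1 \<Longrightarrow> \<bar>Med K (z v)\<bar> < r"
    and mad_ge: "\<And>v. norm2 d v = 1 \<Longrightarrow> \<phi>l \<le> Med K (\<lambda>k. \<bar>z v k - Med K (z v)\<bar>)"
    and mad_le: "\<And>v. norm2 d v = 1 \<Longrightarrow> Med K (\<lambda>k. \<bar>z v k - Med K (z v)\<bar>) \<le> \<phi>u"
  defines "D \<equiv> norm2 d (mat_vec d S (\<lambda>j. nu j - mu j))"
  shows "SDO d K B x nu \<le> ereal ((sqrt (real n) * D + r) / \<phi>l)"
    and "r \<le> sqrt (real n) * D \<Longrightarrow> ereal ((sqrt (real n) * D - r) / \<phi>u) \<le> SDO d K B x nu"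
proof -
  define \<eta> where "\<eta> = mat_vec d S (\<lambda>j. nu j - mu j)"
  have D: "D = norm2 d \<eta>" by (simp add: D_def \<eta>_def)
  have pos: "0 < Med K (\<lambda>k. \<bar>z v k - Med K (z v)\<bar>)" if "norm2 d v = 1" for v
    using mad_ge[OF that] \<phi>(1) by linarith
  have SDO: "SDO d K B x nu = (SUP v\<in>{v. norm2 d v = 1}.
      ereal (\<bar>sqrt (real n) * dot d \<eta> v - Med K (z v)\<bar> / Med K (\<lambda>k. \<bar>z v k - Med K (z v)\<bar>)))"
    unfolding z_def \<eta>_def by (rule SDO_eq_SUP_unit[OF S n K]) (rule pos[unfolded z_def])
  show "SDO d K B x nu \<le> ereal ((sqrt (real n) * D + r) / \<phi>l)"
    unfolding SDO
  proof (rule SUP_least)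
    fix v assume "v \<in> {v. norm2 d v = 1}"
    then have v: "norm2 d v = 1" by simp
    have "\<bar>sqrt (real n) * dot d \<eta> v\<bar> \<le> sqrt (real n) * D"
      using abs_dot_le[of d \<eta> v] v unfolding D abs_mult by (auto intro!: mult_left_mono)
    then have num: "\<bar>sqrt (real n) * dot d \<eta> v - Med K (z v)\<bar> \<le> sqrt (real n) * D + r"
      using med[OF v] by linarith
    show "ereal (\<bar>sqrt (real n) * dot d \<eta> v - Med K (z v)\<bar> / Med K (\<lambda>k. \<bar>z v k - Med K (z v)\<bar>))
        \<le> ereal ((sqrt (real n) * D + r) / \<phi>l)"
      unfolding ereal_less_eq using num mad_ge[OF v] \<phi>(1) by (intro frac_le) auto
  qed
  show "ereal ((sqrt (real n) * D - r) / \<phi>u) \<le> SDO d K B x nu" if r: "r \<le> sqrt (real n) * D"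
  proof -
    obtain v0 where "norm2 d v0 = 1"
    proof (rule that)
      have "norm2 d (\<lambda>j. of_bool (j = 0)) = sqrt (\<Sum>j<d. if j = 0 then 1 else 0)"
        unfolding L2_set_def by (intro arg_cong[where f=sqrt] sum.cong) auto
      then show "norm2 d (\<lambda>j. of_bool (j = 0)) = 1" using d by simp
    qed
    then have "0 < r" using med[of v0] by linarith
    then have "D \<noteq> 0" using r by auto
    then have D_pos: "0 < D" unfolding D by (simp add: less_le)
    define v where "v = (\<lambda>j. inverse D * \<eta> j)"
    have v: "norm2 d v = 1" unfolding v_def using D_pos by (subst norm2_scale) (auto simp: D)
    have "dot d \<eta> v = D" unfolding v_def dot_scale_right dot_self using D_pos by (simp add: D power2_eq_square)
    then have "(sqrt (real n) * D - r) / \<phi>u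
        \<le> \<bar>sqrt (real n) * dot d \<eta> v - Med K (z v)\<bar> / Med K (\<lambda>k. \<bar>z v k - Med K (z v)\<bar>)"
      using med[OF v] mad_le[OF v] pos[OF v] r by (intro frac_le) auto
    then show ?thesis unfolding SDO by (intro SUP_upper2[of v]) (auto simp: v)
  qed
qed

section \<open>Block means, corruption and concentration\<close>

lemma block_mean_cong: "(\<And>i. i \<in> I \<Longrightarrow> x i = y i) \<Longrightarrow> block_mean I x = block_mean I y"
  unfolding block_mean_def by (intro ext arg_cong2[where f="(/)"] sum.cong) auto

text \<open>The blocks are disjoint, so choosing one outlier in each block that contains any is injective, and
  at most \<open>m\<close> blocks are affected.\<close>

lemma fraction_block_mean_corruption:
  assumes B: "equal_block_partition N K B" and Out: "Out \<subseteq> {1..N}" "card Out \<le> m"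
    and xy: "\<forall>i\<in>{1..N} - Out. x i = y i"
  shows "\<bar>fraction K (\<lambda>k. P (block_mean (B k) x)) - fraction K (\<lambda>k. P (block_mean (B k) y))\<bar> \<le> real m / real K"
proof -
  define hit where "hit k \<longleftrightarrow> B k \<inter> Out \<noteq> {}" for k
  have "card {k\<in>{1..K}. hit k} \<le> card Out"
  proof -
    have "\<forall>k\<in>{k\<in>{1..K}. hit k}. \<exists>i. i \<in> B k \<inter> Out" by (auto simp: hit_def)
    then obtain f where f: "\<And>k. k \<in> {k\<in>{1..K}. hit k} \<Longrightarrow> f k \<in> B k \<inter> Out" by metis
    have "inj_on f {k\<in>{1..K}. hit k}"
    proof (rule inj_onI)
      fix k l assume kl: "k \<in> {k\<in>{1..K}. hit k}" "l \<in> {k\<in>{1..K}. hit k}" "f k = f l"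
      then have "B k \<inter> B l \<noteq> {}" using f[OF kl(1)] f[OF kl(2)] by auto
      then show "k = l"
        using B kl unfolding equal_block_partition_def disjoint_family_on_def by blast
    qed
    moreover have "f ` {k\<in>{1..K}. hit k} \<subseteq> Out" using f by blast
    moreover have "finite Out" using Out(1) by (rule finite_subset) simp
    ultimately show ?thesis by (rule card_inj_on_le)
  qed
  then have hit_le: "fraction K hit \<le> real m / real K"
    unfolding fraction_def using Out(2) by (intro divide_right_mono) auto
  have eq: "block_mean (B k) x = block_mean (B k) y" if "k \<in> {1..K}" "\<not> hit k" for k
  proof (rule block_mean_cong)
    fix i assume "i \<in> B k"
    moreover have "B k \<subseteq> {1..N}" using B that(1) unfolding equal_block_partition_def by blast
    ultimately show "x i = y i" using that(2) xy by (auto simp: hit_def)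
  qed
  have "fraction K (\<lambda>k. P (block_mean (B k) x)) \<le> fraction K (\<lambda>k. P (block_mean (B k) y) \<or> hit k)"
    using eq by (intro fraction_mono) metis
  moreover have "fraction K (\<lambda>k. P (block_mean (B k) y)) \<le> fraction K (\<lambda>k. P (block_mean (B k) x) \<or> hit k)"
    using eq by (intro fraction_mono) metis
  ultimately show ?thesis
    using hit_le fraction_disj_le[of K "\<lambda>k. P (block_mean (B k) x)" hit]
      fraction_disj_le[of K "\<lambda>k. P (block_mean (B k) y)" hit] by linarith
qed

text \<open>The restriction to \<open>{..<d}\<close> only serves to land in the space of \<open>euclid d\<close>, whose elements are
  undefined outside this index set.\<close>

lemma (in prob_space) indep_vars_block_mean:
  assumes B: "equal_block_partition N K B" and indep: "indep_vars (\<lambda>_. euclid d) Xt {1..N}"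
  shows "indep_vars (\<lambda>_. euclid d) (\<lambda>k \<omega>. restrict (block_mean (B k) (\<lambda>i. Xt i \<omega>)) {..<d}) {1..K}"
proof -
  have sub: "B k \<subseteq> {1..N}" if "k \<in> {1..K}" for k
    using B that unfolding equal_block_partition_def by blast
  have "indep_vars (\<lambda>k. PiM (B k) (\<lambda>_. euclid d)) (\<lambda>k \<omega>. restrict (\<lambda>i. Xt i \<omega>) (B k)) {1..K}"
    using B by (intro indep_vars_restrict[OF indep] sub) (auto simp: equal_block_partition_def)
  then have "indep_vars (\<lambda>_. euclid d)
      (\<lambda>k. (\<lambda>x. restrict (block_mean (B k) x) {..<d}) \<circ> (\<lambda>\<omega>. restrict (\<lambda>i. Xt i \<omega>) (B k))) {1..K}"
  proof (rule indep_vars_compose)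
    fix k
    show "(\<lambda>x. restrict (block_mean (B k) x) {..<d}) \<in> measurable (PiM (B k) (\<lambda>_. euclid d)) (euclid d)"
    proof (rule measurable_restrict)
      fix j assume j: "j \<in> {..<d}"
      have "(\<lambda>x. x i j) \<in> borel_measurable (PiM (B k) (\<lambda>_. euclid d))" if "i \<in> B k" for i
        using measurable_compose[OF measurable_component_singleton[OF that] measurable_component_singleton[OF j]] .
      then show "(\<lambda>x. block_mean (B k) x j) \<in> borel_measurable (PiM (B k) (\<lambda>_. euclid d))"
        unfolding block_mean_def by (intro borel_measurable_divide borel_measurable_sum) auto
    qed
  qed
  moreover have "(\<lambda>x. restrict (block_mean (B k) x) {..<d}) \<circ> (\<lambda>\<omega>. restrict (\<lambda>i. Xt i \<omega>) (B k))
      = (\<lambda>\<omega>. restrict (block_mean (B k) (\<lambda>i. Xt i \<omega>)) {..<d})" for k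
  proof
    fix \<omega>
    have "block_mean (B k) (restrict (\<lambda>i. Xt i \<omega>) (B k)) = block_mean (B k) (\<lambda>i. Xt i \<omega>)"
      by (rule block_mean_cong) simp
    then show "((\<lambda>x. restrict (block_mean (B k) x) {..<d}) \<circ> (\<lambda>\<omega>. restrict (\<lambda>i. Xt i \<omega>) (B k))) \<omega>
      = restrict (block_mean (B k) (\<lambda>i. Xt i \<omega>)) {..<d}" by simp
  qed
  ultimately show ?thesis by simp
qed

lemma standardized_block_deviation:
  fixes M :: "outcome measure" and Xt :: "nat \<Rightarrow> outcome \<Rightarrow> vect"
  assumes C: "vc_deviation_constant C" and d: "1 \<le> d" and K: "1 \<le> K" and n: "0 < N div K"
    and B: "equal_block_partition N K B" and M: "prob_space M"
    and indep: "prob_space.indep_vars M (\<lambda>_. euclid d) Xt {1..N}"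
    and S: "\<forall>i<d. \<forall>j<d. S i j = S j i"
    and H: "\<forall>k\<in>{1..K}. \<forall>v t. norm2 d v = 1 \<longrightarrow> std_tail M d S mu Xt (B k) v t = H v t"
    and u: "0 < u"
  obtains E where "E \<in> sets M" "1 - exp (- u) \<le> measure M E"
    "\<And>\<omega> v t. \<omega> \<in> E \<Longrightarrow> norm2 d v = 1 \<Longrightarrow>
       \<bar>fraction K (\<lambda>k. t \<le> std_coord d S mu (N div K) v (block_mean (B k) (\<lambda>i. Xt i \<omega>))) - H v t\<bar>
       \<le> C * (sqrt ((real d + 1) / real K) + sqrt (u / real K))"
proof -
  interpret prob_space M by (rule M)
  define n where "n = N div K"
  define Y where "Y = (\<lambda>k \<omega>. restrict (block_mean (B k) (\<lambda>i. Xt i \<omega>)) {..<d})"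
  have indep_Y: "indep_vars (\<lambda>_. euclid d) Y {1..K}"
    unfolding Y_def by (rule indep_vars_block_mean[OF B indep])
  obtain E where E: "E \<in> sets M" "1 - exp (- u) \<le> measure M E"
    "\<And>\<omega> w b. \<omega> \<in> E \<Longrightarrow>
       \<bar>(\<Sum>k=1..K. of_bool (b \<le> dot d (Y k \<omega>) w) - measure M {\<omega>\<in>space M. b \<le> dot d (Y k \<omega>) w})\<bar> / real K
       \<le> C * (sqrt ((real d + 1) / real K) + sqrt (u / real K))"
  proof (rule halfspace_deviation[OF C d K M indep_Y u], goal_cases)
    case (1 E)
    show thesis by (rule that[OF 1(2-4)])
  qed
  have "\<bar>fraction K (\<lambda>k. t \<le> std_coord d S mu n v (block_mean (B k) (\<lambda>i. Xt i \<omega>))) - H v t\<bar>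
       \<le> C * (sqrt ((real d + 1) / real K) + sqrt (u / real K))"
    if \<omega>: "\<omega> \<in> E" and v: "norm2 d v = 1" for \<omega> v t
  proof -
    define w where "w = mat_vec d S v"
    define b where "b = t / sqrt (real n) + dot d mu w"
    have iff: "b \<le> dot d (Y k \<omega>) w \<longleftrightarrow> t \<le> std_coord d S mu n v (block_mean (B k) (\<lambda>i. Xt i \<omega>))" for k \<omega>
    proof -
      have "dot d (Y k \<omega>) w = dot d (block_mean (B k) (\<lambda>i. Xt i \<omega>)) w"
        by (rule dot_cong) (auto simp: Y_def)
      then show ?thesis
        using n unfolding b_def std_coord_def dot_diff_left w_def[symmetric] n_def[symmetric]
        by (simp add: field_simps)
    qed
    have "measure M {\<omega>\<in>space M. b \<le> dot d (Y k \<omega>) w} = H v t" if k: "k \<in> {1..K}" for k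
    proof -
      have card: "card (B k) = n" using B k unfolding equal_block_partition_def n_def by blast
      have "H v t = std_tail M d S mu Xt (B k) v t" using H k v by simp
      then show ?thesis
        using std_coord_block_mean[OF S, of "B k"] n unfolding std_tail_def iff
        by (simp add: card n_def)
    qed
    then have "(\<Sum>k=1..K. of_bool (b \<le> dot d (Y k \<omega>) w) - measure M {\<omega>\<in>space M. b \<le> dot d (Y k \<omega>) w})
        = (\<Sum>k=1..K. of_bool (t \<le> std_coord d S mu n v (block_mean (B k) (\<lambda>i. Xt i \<omega>))) - H v t)"
      unfolding iff by (intro sum.cong) auto
    also have "\<dots> = real K * (fraction K (\<lambda>k. t \<le> std_coord d S mu n v (block_mean (B k) (\<lambda>i. Xt i \<omega>))) - H v t)"
      unfolding sum_subtractf sum_of_bool_fraction[OF K] by (simp add: right_diff_distrib)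
    finally show ?thesis using E(3)[OF \<omega>, of b w] K by (simp add: abs_mult)
  qed
  with E(1,2) show ?thesis using that unfolding n_def by blast
qed

text \<open>The upper tail bound along \<open>-v\<close> is a lower tail bound along \<open>v\<close>.\<close>

lemma abs_Med_std_coord_less:
  assumes K: "1 \<le> K" and tail: "\<And>v. norm2 d v = 1 \<Longrightarrow> fraction K (\<lambda>k. r \<le> std_coord d S mu n v (y k)) < 1/2"
    and v: "norm2 d v = 1"
  shows "\<bar>Med K (\<lambda>k. std_coord d S mu n v (y k))\<bar> < r"
proof -
  define z where "z = (\<lambda>v k. std_coord d S mu n v (y k))"
  have neg: "z (\<lambda>j. - v j) k = - z v k" for k
    unfolding z_def std_coord_def dot_def mat_vec_def by (simp add: sum_negf)
  have "norm2 d (\<lambda>j. - v j) = 1" using v by (simp add: L2_set_def)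
  from tail[OF this] have "fraction K (\<lambda>k. r \<le> - z v k) < 1/2" by (simp add: neg[unfolded z_def] z_def)
  then have "1/2 < fraction K (\<lambda>k. - r < z v k)"
    using fraction_compl[OF K, of "\<lambda>k. r \<le> - z v k"] by (simp add: not_le minus_less_iff)
  then have "- r < Med K (z v)" by (rule Med_gtI)
  moreover have "1/2 < fraction K (\<lambda>k. z v k < r)"
    using tail[OF v] fraction_compl[OF K, of "\<lambda>k. r \<le> z v k"] by (simp add: not_le z_def)
  then have "Med K (z v) < r" by (rule Med_ltI)
  ultimately show ?thesis by (simp add: z_def abs_less_iff)
qed

lemma (in prob_space) std_tail_quantile:
  assumes X: "\<And>i. i \<in> I \<Longrightarrow> Xt i \<in> measurable M (euclid d)"
    and S: "\<forall>i<d. \<forall>j<d. S i j = S j i" and p: "0 < p" "p < 1"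
    and H: "H = std_tail M d S mu Xt I v"
  shows "p \<le> H (W_quantile H p)" and "W_quantile H p < t \<Longrightarrow> H t < p"
proof -
  define Z where "Z = (\<lambda>\<omega>. 1 / sqrt (real (card I)) * (\<Sum>i\<in>I. dot d (mat_vec d S (\<lambda>j. Xt i \<omega> j - mu j)) v))"
  have "(\<lambda>\<omega>. dot d (Xt i \<omega>) (mat_vec d S v)) \<in> borel_measurable M" if "i \<in> I" for i
    using X[OF that] dot_measurable by (rule measurable_compose)
  then have Z: "Z \<in> borel_measurable M"
    unfolding Z_def dot_mat_vec_symmetric[OF S] dot_diff_left
    by (intro borel_measurable_times borel_measurable_const borel_measurable_sum borel_measurable_diff)
  have "H = (\<lambda>t. prob {\<omega>\<in>space M. t \<le> Z \<omega>})"
    by (simp add: H std_tail_def Z_def fun_eq_iff)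
  then show "p \<le> H (W_quantile H p)" "W_quantile H p < t \<Longrightarrow> H t < p"
    using W_quantile_props[OF Z p, of H] by blast+
qed

theorem proposition3:
  fixes C0 :: real
  assumes "vc_deviation_constant C0"
  shows "\<exists>c0>0. \<exists>c1>0.
    \<forall>(N::nat) (d::nat) (K::nat) (B :: nat \<Rightarrow> nat set)
     (M :: outcome measure) (Xt :: nat \<Rightarrow> outcome \<Rightarrow> vect) (X :: nat \<Rightarrow> outcome \<Rightarrow> vect)
     (mu :: vect) (Sg :: matr) (S :: matr) (H :: vect \<Rightarrow> real \<Rightarrow> real) (W :: vect \<Rightarrow> real \<Rightarrow> real)
     (m::nat) (\<epsilon>::real) (\<phi>l::real) (\<phi>u::real) (u::real) (r::real).
      1 \<le> N \<longrightarrow> 1 \<le> d \<longrightarrow> K \<in> {1..N} \<longrightarrow> K dvd N \<longrightarrow>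
      equal_block_partition N K B \<longrightarrow>
      prob_space M \<longrightarrow>
      prob_space.indep_vars M (\<lambda>_. euclid d) Xt {1..N} \<longrightarrow>
      (\<forall>i\<in>{1..N}. has_mean M d (Xt i) mu \<and> has_covariance M d (Xt i) mu Sg) \<longrightarrow>
      invertible_matr d Sg \<longrightarrow>
      inv_sqrt_mat d Sg S \<longrightarrow>
      adversarial_corruption M N m Xt X \<longrightarrow>
      H = std_tail M d S mu Xt {1..N div K} \<longrightarrow>
      (\<forall>k\<in>{1..K}. \<forall>v t. norm2 d v = 1 \<longrightarrow> std_tail M d S mu Xt (B k) v t = H v t) \<longrightarrow>
      W = (\<lambda>v. W_quantile (H v)) \<longrightarrow>
      0 < \<epsilon> \<longrightarrow> \<epsilon> < 1/8 \<longrightarrow> 0 < \<phi>l \<longrightarrow> \<phi>l < \<phi>u \<longrightarrow>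
      (\<forall>v. norm2 d v = 1 \<longrightarrow>
         max (W v (1/4 - 2*\<epsilon>) - W v (1/2 + 2*\<epsilon>)) (W v (1/2 - 2*\<epsilon>) - W v (3/4 + 2*\<epsilon>)) \<le> \<phi>u) \<longrightarrow>
      (\<forall>v. norm2 d v = 1 \<longrightarrow>
         min (W v (1/4 + 2*\<epsilon>) - W v (1/2 - 2*\<epsilon>)) (W v (1/2 + 2*\<epsilon>) - W v (3/4 - 2*\<epsilon>)) \<ge> \<phi>l) \<longrightarrow>
      real m \<le> \<epsilon> * real K \<longrightarrow>
      real K \<ge> c0 * real d / \<epsilon>\<^sup>2 \<longrightarrow>
      0 < u \<longrightarrow>
      C0 * (sqrt ((real d + 1) / real K) + sqrt (u / real K))
        + (SUP v\<in>{v. norm2 d v = 1}. H v r) + real m / real K < 1/2 \<longrightarrow>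
      (\<exists>E\<in>sets M. measure M E \<ge> 1 - exp (- u) - exp (- c1 * \<epsilon>\<^sup>2 * real K) \<and>
        (\<forall>\<omega>\<in>E. \<forall>nu :: vect.
          let D = norm2 d (mat_vec d S (\<lambda>j. nu j - mu j));
              s = sqrt (real K / real N);
              O_nu = SDO d K B (\<lambda>i. X i \<omega>) nu
          in (D \<ge> 2 * s * r \<longrightarrow>
                ereal (D / (2 * \<phi>u * s)) \<le> O_nu \<and> O_nu \<le> ereal (3 * D / (2 * \<phi>l * s))) \<and>
             (D \<le> 2 * s * r \<longrightarrow> O_nu \<le> ereal (3 / \<phi>l * r))))"
proof -
  (* With these values each square root in the deviation bound for u = c1 * \<epsilon>\<^sup>2 * K, multiplied
     by C0, is at most \<epsilon> / 4. *)
  define c0 where "c0 = 32 * C0\<^sup>2"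
  define c1 where "c1 = 1 / (16 * C0\<^sup>2)"
  have C0: "0 < C0" using assms by (simp add: vc_deviation_constant_def)
  have c: "0 < c0" "0 < c1" using C0 by (auto simp: c0_def c1_def)
  show ?thesis
  proof (rule exI[of _ c0], rule conjI[OF c(1)], rule exI[of _ c1], rule conjI[OF c(2)], intro allI impI)
    fix N d K :: nat and B :: "nat \<Rightarrow> nat set" and M :: "outcome measure"
      and Xt X :: "nat \<Rightarrow> outcome \<Rightarrow> vect" and mu :: vect and Sg S :: matr
      and H W :: "vect \<Rightarrow> real \<Rightarrow> real" and m :: nat and \<epsilon> \<phi>l \<phi>u u r :: real
    assume N: "1 \<le> N" and d: "1 \<le> d" and KN: "K \<in> {1..N}" "K dvd N"
      and B: "equal_block_partition N K B" and M: "prob_space M"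
      and indep: "prob_space.indep_vars M (\<lambda>_. euclid d) Xt {1..N}"
      and S: "inv_sqrt_mat d Sg S" and X: "adversarial_corruption M N m Xt X"
      and H: "H = std_tail M d S mu Xt {1..N div K}"
      and HB: "\<forall>k\<in>{1..K}. \<forall>v t. norm2 d v = 1 \<longrightarrow> std_tail M d S mu Xt (B k) v t = H v t"
      and W: "W = (\<lambda>v. W_quantile (H v))"
      and \<epsilon>: "0 < \<epsilon>" "\<epsilon> < 1/8" and \<phi>: "0 < \<phi>l" "\<phi>l < \<phi>u"
      and up: "\<forall>v. norm2 d v = 1 \<longrightarrow>
         max (W v (1/4 - 2*\<epsilon>) - W v (1/2 + 2*\<epsilon>)) (W v (1/2 - 2*\<epsilon>) - W v (3/4 + 2*\<epsilon>)) \<le> \<phi>u"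
      and lo: "\<forall>v. norm2 d v = 1 \<longrightarrow>
         min (W v (1/4 + 2*\<epsilon>) - W v (1/2 - 2*\<epsilon>)) (W v (1/2 + 2*\<epsilon>) - W v (3/4 - 2*\<epsilon>)) \<ge> \<phi>l"
      and m: "real m \<le> \<epsilon> * real K" and Kd: "real K \<ge> c0 * real d / \<epsilon>\<^sup>2" and u: "0 < u"
      and r: "C0 * (sqrt ((real d + 1) / real K) + sqrt (u / real K))
        + (SUP v\<in>{v. norm2 d v = 1}. H v r) + real m / real K < 1/2"
    interpret prob_space M by (rule M)
    have K: "1 \<le> K" using KN by simp
    define n where "n = N div K"
    have n: "0 < n" using KN K by (auto simp: n_def div_greater_zero_iff)
    have sym: "\<forall>i<d. \<forall>j<d. S i j = S j i" using S by (simp add: inv_sqrt_mat_def)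
    define z where "z Y v = (\<lambda>k. std_coord d S mu n v (block_mean (B k) Y))" for Y v
    define \<delta>1 where "\<delta>1 = C0 * (sqrt ((real d + 1) / real K) + sqrt (u / real K))"
    define u2 where "u2 = c1 * \<epsilon>\<^sup>2 * real K"
    have u2: "0 < u2" using c \<epsilon> K by (simp add: u2_def)
    define \<delta>2 where "\<delta>2 = C0 * (sqrt ((real d + 1) / real K) + sqrt (u2 / real K))"
    (* Strictly less than \<epsilon>: corruption may use up a full \<epsilon>, and the total must stay below 2 * \<epsilon>
       to produce strict majorities. *)
    have "\<delta>2 < \<epsilon>"
    proof -
      have "16 * C0\<^sup>2 * (real d + 1) \<le> 16 * C0\<^sup>2 * (2 * real d)" using d by (intro mult_left_mono) auto
      also have "\<dots> = c0 * real d" by (simp add: c0_def)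
      also have "\<dots> \<le> \<epsilon>\<^sup>2 * real K" using Kd \<epsilon> by (simp add: divide_le_eq mult.commute)
      finally have "(real d + 1) / real K \<le> (\<epsilon> / (4 * C0))\<^sup>2"
        using K C0 by (simp add: power_divide power_mult_distrib field_simps)
      then have "sqrt ((real d + 1) / real K) \<le> \<epsilon> / (4 * C0)"
        using \<epsilon> C0 by (intro real_le_lsqrt) auto
      moreover have "u2 / real K = (\<epsilon> / (4 * C0))\<^sup>2"
        using K by (simp add: u2_def c1_def power_divide power_mult_distrib)
      then have "sqrt (u2 / real K) = \<epsilon> / (4 * C0)" using \<epsilon> C0 by simp
      ultimately have "\<delta>2 \<le> C0 * (\<epsilon> / (4 * C0) + \<epsilon> / (4 * C0))"
        unfolding \<delta>2_def using C0 by (intro mult_left_mono add_mono) auto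
      also have "\<dots> < \<epsilon>" using C0 \<epsilon> by simp
      finally show ?thesis .
    qed
    obtain E1 where E1: "E1 \<in> sets M" "1 - exp (- u) \<le> prob E1"
      "\<And>\<omega> v t. \<omega> \<in> E1 \<Longrightarrow> norm2 d v = 1 \<Longrightarrow>
         \<bar>fraction K (\<lambda>k. t \<le> z (\<lambda>i. Xt i \<omega>) v k) - H v t\<bar> \<le> \<delta>1"
      using standardized_block_deviation[OF assms d K n[unfolded n_def] B M indep sym HB u]
      unfolding z_def \<delta>1_def n_def by metis
    obtain E2 where E2: "E2 \<in> sets M" "1 - exp (- u2) \<le> prob E2"
      "\<And>\<omega> v t. \<omega> \<in> E2 \<Longrightarrow> norm2 d v = 1 \<Longrightarrow>
         \<bar>fraction K (\<lambda>k. t \<le> z (\<lambda>i. Xt i \<omega>) v k) - H v t\<bar> \<le> \<delta>2"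
      using standardized_block_deviation[OF assms d K n[unfolded n_def] B M indep sym HB u2]
      unfolding z_def \<delta>2_def n_def by metis
    have "prob (E1 - E2) \<le> prob (space M - E2)"
      using E1(1) E2(1) sets.sets_into_space by (intro finite_measure_mono) auto
    then have "1 - exp (- u) - exp (- u2) \<le> prob (E1 \<inter> E2)"
      using E1(1,2) E2(1,2) finite_measure_Diff'[OF E1(1) E2(1)] prob_compl[OF E2(1)] by linarith
    then have prob_E: "1 - exp (- u) - exp (- c1 * \<epsilon>\<^sup>2 * real K) \<le> prob (E1 \<inter> E2)"
      by (simp add: u2_def)
    have quantile: "p \<le> H v (W v p)" "W v p < t \<Longrightarrow> H v t < p" if p: "0 < p" "p < 1" for v p t
    proof -
      have XM: "Xt i \<in> measurable M (euclid d)" if "i \<in> {1..N div K}" for i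
      proof -
        have "i \<in> {1..N}" using that by (auto intro: order.trans[OF _ div_le_dividend])
        then show ?thesis using indep by (auto simp: indep_vars_def)
      qed
      show "p \<le> H v (W v p)"
        unfolding W H by (rule std_tail_quantile(1)[OF _ sym p refl]) (rule XM)
      show "H v t < p" if "W v p < t"
        using that unfolding W H by (rule std_tail_quantile(2)[OF _ sym p refl, rotated]) (rule XM)
    qed
    have H_le_SUP: "H v r \<le> (SUP v\<in>{v. norm2 d v = 1}. H v r)" if "norm2 d v = 1" for v
    proof (rule cSUP_upper)
      show "bdd_above ((\<lambda>v. H v r) ` {v. norm2 d v = 1})"
        by (rule bdd_aboveI2[where M=1]) (simp add: H std_tail_def)
    qed (use that in simp)
    have "let D = norm2 d (mat_vec d S (\<lambda>j. nu j - mu j));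
              s = sqrt (real K / real N);
              O_nu = SDO d K B (\<lambda>i. X i \<omega>) nu
          in (D \<ge> 2 * s * r \<longrightarrow>
                ereal (D / (2 * \<phi>u * s)) \<le> O_nu \<and> O_nu \<le> ereal (3 * D / (2 * \<phi>l * s))) \<and>
             (D \<le> 2 * s * r \<longrightarrow> O_nu \<le> ereal (3 / \<phi>l * r))"
      if \<omega>: "\<omega> \<in> E1 \<inter> E2" for \<omega> nu
    proof -
      have "\<omega> \<in> space M" using \<omega> E1(1) sets.sets_into_space by auto
      then obtain Out where Out: "Out \<subseteq> {1..N}" "card Out \<le> m" "\<forall>i\<in>{1..N} - Out. X i \<omega> = Xt i \<omega>"
        using X unfolding adversarial_corruption_def by blast
      define x where "x = (\<lambda>i. X i \<omega>)"
      have corr: "\<bar>fraction K (\<lambda>k. t \<le> z x v k) - fraction K (\<lambda>k. t \<le> z (\<lambda>i. Xt i \<omega>) v k)\<bar> \<le> real m / real K" for v t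
        unfolding z_def x_def
        using fraction_block_mean_corruption[OF B Out, of "\<lambda>b. t \<le> std_coord d S mu n v b"] .
      have "real m / real K \<le> \<epsilon>" using m K by (simp add: divide_le_eq)
      then have close: "\<bar>fraction K (\<lambda>k. t \<le> z x v k) - H v t\<bar> < 2 * \<epsilon>" if "norm2 d v = 1" for v t
        using corr[of t v] E2(3)[of \<omega> v t] \<omega> that \<open>\<delta>2 < \<epsilon>\<close> by auto
      have mad: "\<phi>l \<le> Med K (\<lambda>k. \<bar>z x v k - Med K (z x v)\<bar>)" "Med K (\<lambda>k. \<bar>z x v k - Med K (z x v)\<bar>) \<le> \<phi>u"
        if v: "norm2 d v = 1" for v
        by (rule MAD_bounds[where W="W v" and H="H v"],
            (assumption | rule K \<epsilon> close[OF v] quantile \<phi>(1) up[rule_format, OF v] lo[rule_format, OF v])+)+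
      have tail: "fraction K (\<lambda>k. r \<le> z x v k) < 1/2" if v: "norm2 d v = 1" for v
      proof -
        have "\<bar>fraction K (\<lambda>k. r \<le> z (\<lambda>i. Xt i \<omega>) v k) - H v r\<bar> \<le> \<delta>1" using E1(3) \<omega> v by blast
        then show ?thesis using corr[of r v] r H_le_SUP[OF v] unfolding \<delta>1_def by linarith
      qed
      have med: "\<bar>Med K (z x v)\<bar> < r" if "norm2 d v = 1" for v
        using abs_Med_std_coord_less[OF K tail[unfolded z_def] that] unfolding z_def .
      define D where "D = norm2 d (mat_vec d S (\<lambda>j. nu j - mu j))"
      note bounds = SDO_bounds[OF S n K \<phi>(1) order.strict_trans[OF \<phi>] d med[unfolded z_def] mad[unfolded z_def],
          of nu, folded D_def]
      have s: "sqrt (real K / real N) = 1 / sqrt (real n)"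
        using KN K by (auto simp: n_def real_sqrt_divide real_sqrt_mult)
      define R where "R = sqrt (real n)"
      have R: "0 < R" using n by (simp add: R_def)
      have large: "ereal (D / (2 * \<phi>u * (1 / R))) \<le> SDO d K B x nu"
        "SDO d K B x nu \<le> ereal (3 * D / (2 * \<phi>l * (1 / R)))" if "2 * (1 / R) * r \<le> D"
      proof -
        have rD: "2 * r \<le> R * D" using that R by (simp add: field_simps)
        have D0: "0 \<le> R * D" using R by (simp add: D_def)
        have "D / (2 * \<phi>u * (1 / R)) \<le> (R * D - r) / \<phi>u"
          using rD \<phi> R by (simp add: field_simps)
        moreover have "ereal ((R * D - r) / \<phi>u) \<le> SDO d K B x nu"
          using bounds(2) rD D0 unfolding R_def by linarith
        ultimately show "ereal (D / (2 * \<phi>u * (1 / R))) \<le> SDO d K B x nu"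
          by (meson ereal_less_eq(3) order.trans)
        have "(R * D + r) / \<phi>l \<le> 3 * D / (2 * \<phi>l * (1 / R))"
          using rD \<phi> R by (simp add: field_simps)
        then show "SDO d K B x nu \<le> ereal (3 * D / (2 * \<phi>l * (1 / R)))"
          using bounds(1) unfolding R_def by (meson ereal_less_eq(3) order.trans)
      qed
      have small: "SDO d K B x nu \<le> ereal (3 / \<phi>l * r)" if "D \<le> 2 * (1 / R) * r"
      proof -
        have "R * D \<le> 2 * r" using that R by (simp add: field_simps)
        then have "(R * D + r) / \<phi>l \<le> 3 / \<phi>l * r" using \<phi> by (simp add: field_simps)
        then show ?thesis using bounds(1) unfolding R_def by (meson ereal_less_eq(3) order.trans)
      qed
      show ?thesis
        unfolding Let_def s D_def[symmetric] x_def[symmetric] R_def[symmetric]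
        using large small by blast
    qed
    then show "\<exists>E\<in>sets M. prob E \<ge> 1 - exp (- u) - exp (- c1 * \<epsilon>\<^sup>2 * real K) \<and>
        (\<forall>\<omega>\<in>E. \<forall>nu :: vect.
          let D = norm2 d (mat_vec d S (\<lambda>j. nu j - mu j));
              s = sqrt (real K / real N);
              O_nu = SDO d K B (\<lambda>i. X i \<omega>) nu
          in (D \<ge> 2 * s * r \<longrightarrow>
                ereal (D / (2 * \<phi>u * s)) \<le> O_nu \<and> O_nu \<le> ereal (3 * D / (2 * \<phi>l * s))) \<and>
             (D \<le> 2 * s * r \<longrightarrow> O_nu \<le> ereal (3 / \<phi>l * r)))"
      using prob_E E1(1) E2(1) by (intro bexI[of _ "E1 \<inter> E2"] conjI ballI allI) (auto intro: sets.Int)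
  qed
qed

end
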